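(* Let $K_{\mathrm{best}}$ denote the infimum of all constants $K \geq 0$ with the following property: for all $C^{\ast}$-algebras $A$ and $B$ and every jointly completely bounded bilinear form $u: A \times B \rightarrow \mathbb{C}$, there exist bilinear forms $u_1, u_2 : A \times B \rightarrow \mathbb{C}$ such that $u = u_1 + u_2$, both $u_1$ and $u_2^t$ are completely bounded, and \[ \|u_1\|_{cb} + \|u_2^t\|_{cb} \leq K \|u\|_{jcb}. \] Then $K_{\mathrm{best}} > 1$.
   Context: Let $A$ and $B$ be $C^{\ast}$-algebras and let $u : A \times B \rightarrow \mathbb{C}$ be a bounded bilinear form. Transpose: $u^t : B \times A \rightarrow \mathbb{C}$ is defined by $u^t(b,a) = u(a,b)$. Completely bounded bilinear forms (in the sense of Christensen and Sinclair): for $n \geq 1$ let $u_{(n)} : M_n(A) \times M_n(B) \rightarrow M_n(\mathbb{C})$ be the map $([a_{ij}],[b_{ij}]) \mapsto \left[\sum_{k=1}^n u(a_{ik},b_{kj})\right]_{i,j}$. The form $u$ is completely bounded if $\|u\|_{cb} := \sup_{n \geq 1} \|u_{(n)}\|$ is finite, where $\|u_{(n)}\|$ is the norm as a bilinear map; put $\|u\|_{cb} = \infty$ otherwise. Equivalently, $u$ is completely bounded if there exist a constant $C \geq 0$ and states $f$ on $A$ and $g$ on $B$ such that $|u(a,b)| \leq C f(aa^* )^{1/2} g(b^*b)^{1/2}$ for all $a \in A$, $b \in B$, and $\|u\|_{cb}$ is the smallest such $C$. Jointly completely bounded bilinear forms: let $\tilde{u} : A \rightarrow B^*$ be the bounded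 linear map determined by $u(a,b) = \langle \tilde{u}(a), b\rangle$, where $B^*$ carries its standard dual operator space structure. The form $u$ is jointly completely bounded if $\tilde{u}$ is completely bounded, and then $\|u\|_{jcb} := \|\tilde{u}\|_{cb}$; put $\|u\|_{jcb} = \infty$ otherwise. Equivalently, $\|u\|_{jcb} = \sup_{n \geq 1} \|u_n\|$, where $u_n$ is the bilinear map from $M_n(A) \times M_n(B)$ to $M_n(\mathbb{C}) \otimes M_n(\mathbb{C}) \cong M_{n^2}(\mathbb{C})$ given, identifying $M_n(A) = A \otimes M_n(\mathbb{C})$ and $M_n(B) = B \otimes M_n(\mathbb{C})$, by \[ u_n\Big(\sum_i a_i \otimes c_i, \sum_j b_j \otimes d_j\Big) = \sum_{i,j} u(a_i,b_j)\, c_i \otimes d_j . \] *)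

theory Defs
  imports
    "Jordan_Normal_Form.VS_Connect"
    "HOL-Analysis.L2_Norm"
    "HOL-Library.Extended_Nonnegative_Real"
    "HOL-Library.Equipollence"
begin

section \<open>C*-algebras\<close>

record 'a cstar_struct = "(complex, 'a) module" +
  star :: "'a \<Rightarrow> 'a"
  cnorm :: "'a \<Rightarrow> real"

text \<open>C*-algebras are not required to have a unit: no axiom mentions the field \<^const>\<open>one\<close>
  that the record inherits from rings.  The zero algebra is allowed.\<close>

locale cstar_algebra = Module.module "class_ring :: complex ring" A
  for A :: "('a, 'm) cstar_struct_scheme" (structure) +
  assumes mult_closed: "\<lbrakk>x \<in> carrier A; y \<in> carrier A\<rbrakk> \<Longrightarrow> x \<otimes> y \<in> carrier A"
    and mult_assoc: "\<lbrakk>x \<in> carrier A; y \<in> carrier A; z \<in> carrier A\<rbrakk> \<Longrightarrow>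
          (x \<otimes> y) \<otimes> z = x \<otimes> (y \<otimes> z)"
    and distrib_right: "\<lbrakk>x \<in> carrier A; y \<in> carrier A; z \<in> carrier A\<rbrakk> \<Longrightarrow>
          (x \<oplus> y) \<otimes> z = x \<otimes> z \<oplus> y \<otimes> z"
    and distrib_left: "\<lbrakk>x \<in> carrier A; y \<in> carrier A; z \<in> carrier A\<rbrakk> \<Longrightarrow>
          z \<otimes> (x \<oplus> y) = z \<otimes> x \<oplus> z \<otimes> y"
    and mult_smult_left: "\<lbrakk>x \<in> carrier A; y \<in> carrier A\<rbrakk> \<Longrightarrow>
          (c \<odot> x) \<otimes> y = c \<odot> (x \<otimes> y)"
    and mult_smult_right: "\<lbrakk>x \<in> carrier A; y \<in> carrier A\<rbrakk> \<Longrightarrow>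
          x \<otimes> (c \<odot> y) = c \<odot> (x \<otimes> y)"
    and star_closed: "x \<in> carrier A \<Longrightarrow> star A x \<in> carrier A"
    and star_star: "x \<in> carrier A \<Longrightarrow> star A (star A x) = x"
    and star_add: "\<lbrakk>x \<in> carrier A; y \<in> carrier A\<rbrakk> \<Longrightarrow> star A (x \<oplus> y) = star A x \<oplus> star A y"
    and star_smult: "x \<in> carrier A \<Longrightarrow> star A (c \<odot> x) = cnj c \<odot> star A x"
    and star_mult: "\<lbrakk>x \<in> carrier A; y \<in> carrier A\<rbrakk> \<Longrightarrow> star A (x \<otimes> y) = star A y \<otimes> star A x"
    and norm_eq_0_iff: "x \<in> carrier A \<Longrightarrow> cnorm A x = 0 \<longleftrightarrow> x = \<zero>"
    and norm_triangle: "\<lbrakk>x \<in> carrier A; y \<in> carrier A\<rbrakk> \<Longrightarrow>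
          cnorm A (x \<oplus> y) \<le> cnorm A x + cnorm A y"
    and norm_smult: "x \<in> carrier A \<Longrightarrow> cnorm A (c \<odot> x) = cmod c * cnorm A x"
    and norm_mult: "\<lbrakk>x \<in> carrier A; y \<in> carrier A\<rbrakk> \<Longrightarrow>
          cnorm A (x \<otimes> y) \<le> cnorm A x * cnorm A y"
    and cstar_identity: "x \<in> carrier A \<Longrightarrow> cnorm A (star A x \<otimes> x) = (cnorm A x)\<^sup>2"
    and complete: "\<lbrakk>\<And>k. X k \<in> carrier A;
          \<forall>e>0. \<exists>k0. \<forall>k\<ge>k0. \<forall>l\<ge>k0. cnorm A (X k \<ominus> X l) < e\<rbrakk> \<Longrightarrow>
          \<exists>x\<in>carrier A. (\<lambda>k. cnorm A (X k \<ominus> x)) \<longlonglongrightarrow> 0"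

definition matrix_cstar ::
    "nat \<Rightarrow> 'a cstar_struct \<Rightarrow> ('a mat \<Rightarrow> real) \<Rightarrow> 'a mat cstar_struct" where
  "matrix_cstar n A N = \<lparr>
     carrier = {X \<in> carrier_mat n n. \<forall>i<n. \<forall>j<n. X $$ (i, j) \<in> carrier A},
     monoid.mult = (\<lambda>X Y. mat n n (\<lambda>(i, j). \<Oplus>\<^bsub>A\<^esub>k\<in>{..<n}. X $$ (i, k) \<otimes>\<^bsub>A\<^esub> Y $$ (k, j))),
     one = mat n n (\<lambda>(i, j). if i = j then \<one>\<^bsub>A\<^esub> else \<zero>\<^bsub>A\<^esub>),
     ring.zero = mat n n (\<lambda>(i, j). \<zero>\<^bsub>A\<^esub>),
     ring.add = (\<lambda>X Y. mat n n (\<lambda>(i, j). X $$ (i, j) \<oplus>\<^bsub>A\<^esub> Y $$ (i, j))),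
     module.smult = (\<lambda>c X. mat n n (\<lambda>(i, j). c \<odot>\<^bsub>A\<^esub> X $$ (i, j))),
     star = (\<lambda>X. mat n n (\<lambda>(i, j). star A (X $$ (j, i)))),
     cnorm = N\<rparr>"

text \<open>For a C*-algebra \<open>A\<close> the *-algebra of \<open>n \<times> n\<close> matrices over \<open>A\<close> carries exactly one norm
  that makes it a C*-algebra.  Such a norm is only determined on the carrier, so it is its value
  at a given matrix, rather than the norm as a function, that is described uniquely.\<close>

definition matrix_norm :: "nat \<Rightarrow> 'a cstar_struct \<Rightarrow> 'a mat \<Rightarrow> real" where
  "matrix_norm n A X = (THE r. \<exists>N. cstar_algebra (matrix_cstar n A N) \<and> N X = r)"

definition matrix_ball :: "nat \<Rightarrow> 'a cstar_struct \<Rightarrow> 'a mat set" where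
  "matrix_ball n A =
     {X \<in> carrier_mat n n. (\<forall>i<n. \<forall>j<n. X $$ (i, j) \<in> carrier A) \<and> matrix_norm n A X \<le> 1}"

definition l2_norm :: "complex vec \<Rightarrow> real" where
  "l2_norm v = L2_set (\<lambda>i. cmod (v $ i)) {..<dim_vec v}"

definition cmat_norm :: "complex mat \<Rightarrow> ennreal" where
  "cmat_norm M = (SUP v\<in>{v \<in> carrier_vec (dim_col M). l2_norm v \<le> 1}. ennreal (l2_norm (M *\<^sub>v v)))"


section \<open>Bilinear forms\<close>

text \<open>Forms on \<open>A \<times> B\<close> are curried functions; their values off the carriers are irrelevant.\<close>

definition bilinear_form ::
    "'a cstar_struct \<Rightarrow> 'b cstar_struct \<Rightarrow> ('a \<Rightarrow> 'b \<Rightarrow> complex) \<Rightarrow> bool" where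
  "bilinear_form A B u \<longleftrightarrow>
     (\<forall>a\<in>carrier A. \<forall>a'\<in>carrier A. \<forall>b\<in>carrier B. u (a \<oplus>\<^bsub>A\<^esub> a') b = u a b + u a' b) \<and>
     (\<forall>a\<in>carrier A. \<forall>b\<in>carrier B. \<forall>b'\<in>carrier B. u a (b \<oplus>\<^bsub>B\<^esub> b') = u a b + u a b') \<and>
     (\<forall>c. \<forall>a\<in>carrier A. \<forall>b\<in>carrier B. u (c \<odot>\<^bsub>A\<^esub> a) b = c * u a b) \<and>
     (\<forall>c. \<forall>a\<in>carrier A. \<forall>b\<in>carrier B. u a (c \<odot>\<^bsub>B\<^esub> b) = c * u a b)"

definition bounded_bilinear_form ::
    "'a cstar_struct \<Rightarrow> 'b cstar_struct \<Rightarrow> ('a \<Rightarrow> 'b \<Rightarrow> complex) \<Rightarrow> bool" where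
  "bounded_bilinear_form A B u \<longleftrightarrow> bilinear_form A B u \<and>
     (\<exists>C. \<forall>a\<in>carrier A. \<forall>b\<in>carrier B. cmod (u a b) \<le> C * cnorm A a * cnorm B b)"

definition transpose_form :: "('a \<Rightarrow> 'b \<Rightarrow> complex) \<Rightarrow> 'b \<Rightarrow> 'a \<Rightarrow> complex" where
  "transpose_form u = (\<lambda>b a. u a b)"


section \<open>Complete boundedness in the sense of Christensen and Sinclair\<close>

definition amplification ::
    "nat \<Rightarrow> ('a \<Rightarrow> 'b \<Rightarrow> complex) \<Rightarrow> 'a mat \<Rightarrow> 'b mat \<Rightarrow> complex mat" where
  "amplification n u X Y = mat n n (\<lambda>(i, j). \<Sum>k<n. u (X $$ (i, k)) (Y $$ (k, j)))"

definition cb_norm ::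
    "'a cstar_struct \<Rightarrow> 'b cstar_struct \<Rightarrow> ('a \<Rightarrow> 'b \<Rightarrow> complex) \<Rightarrow> ennreal" where
  "cb_norm A B u =
     (SUP n\<in>{1..}. SUP X\<in>matrix_ball n A. SUP Y\<in>matrix_ball n B. cmat_norm (amplification n u X Y))"

definition completely_bounded ::
    "'a cstar_struct \<Rightarrow> 'b cstar_struct \<Rightarrow> ('a \<Rightarrow> 'b \<Rightarrow> complex) \<Rightarrow> bool" where
  "completely_bounded A B u \<longleftrightarrow> bounded_bilinear_form A B u \<and> cb_norm A B u < \<infinity>"


section \<open>Joint complete boundedness\<close>

text \<open>The cb-norm of a linear map \<open>T\<close> from \<open>B\<close> to the \<open>n \<times> n\<close> complex matrices.  Matrices of size
  \<open>m\<close> with entries in the \<open>n \<times> n\<close> matrices are flattened blockwise: row index \<open>k * n + i\<close> is row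
  \<open>i\<close> of block row \<open>k\<close>, and likewise for columns.\<close>

definition cb_norm_to_mat :: "'b cstar_struct \<Rightarrow> nat \<Rightarrow> ('b \<Rightarrow> complex mat) \<Rightarrow> ennreal" where
  "cb_norm_to_mat B n T = (SUP m\<in>{1..}. SUP Y\<in>matrix_ball m B. cmat_norm
     (mat (m * n) (m * n) (\<lambda>(p, q). T (Y $$ (p div n, q div n)) $$ (p mod n, q mod n))))"

text \<open>The dual operator space structure: a matrix of functionals on \<open>B\<close> is normed as a completely
  bounded map from \<open>B\<close> to the \<open>n \<times> n\<close> complex matrices.\<close>

definition dual_matrix_norm :: "'b cstar_struct \<Rightarrow> nat \<Rightarrow> ('b \<Rightarrow> complex) mat \<Rightarrow> ennreal" where
  "dual_matrix_norm B n F = cb_norm_to_mat B n (\<lambda>b. map_mat (\<lambda>f. f b) F)"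

text \<open>The map from \<open>A\<close> to the dual of \<open>B\<close> induced by a curried form \<open>u\<close> is \<open>u\<close> itself, and
  \<open>map_mat u\<close> is its amplification to matrices; hence this is the cb-norm of the induced map.\<close>

definition jcb_norm ::
    "'a cstar_struct \<Rightarrow> 'b cstar_struct \<Rightarrow> ('a \<Rightarrow> 'b \<Rightarrow> complex) \<Rightarrow> ennreal" where
  "jcb_norm A B u = (SUP n\<in>{1..}. SUP X\<in>matrix_ball n A. dual_matrix_norm B n (map_mat u X))"

definition jointly_completely_bounded ::
    "'a cstar_struct \<Rightarrow> 'b cstar_struct \<Rightarrow> ('a \<Rightarrow> 'b \<Rightarrow> complex) \<Rightarrow> bool" where
  "jointly_completely_bounded A B u \<longleftrightarrow> bounded_bilinear_form A B u \<and> jcb_norm A B u < \<infinity>"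


section \<open>The best constant\<close>

text \<open>The type argument is a universe: \<open>A\<close> and \<open>B\<close> range over all C*-algebras whose carrier is a
  set of elements of that type.  Nonzero C*-algebras have at least continuum many elements, so in a
  type smaller than the continuum only the zero algebra exists, whereas a type at least as large as
  the continuum contains an isomorphic copy of every separable C*-algebra.\<close>

definition decomposition_constant :: "'a itself \<Rightarrow> real \<Rightarrow> bool" where
  "decomposition_constant (_ :: 'a itself) K \<longleftrightarrow>
     (\<forall>(A :: 'a cstar_struct) (B :: 'a cstar_struct) u.
        cstar_algebra A \<longrightarrow> cstar_algebra B \<longrightarrow> jointly_completely_bounded A B u \<longrightarrow>
        (\<exists>u1 u2. bilinear_form A B u1 \<and> bilinear_form A B u2 \<and>
           (\<forall>a\<in>carrier A. \<forall>b\<in>carrier B. u a b = u1 a b + u2 a b) \<and>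
           completely_bounded A B u1 \<and> completely_bounded B A (transpose_form u2) \<and>
           cb_norm A B u1 + cb_norm B A (transpose_form u2) \<le> ennreal K * jcb_norm A B u))"

text \<open>The infimum is taken in the extended reals, so it is infinite if there is no such constant.\<close>

definition K_best :: "'a itself \<Rightarrow> ennreal" where
  "K_best U = (INF K\<in>{K. 0 \<le> K \<and> decomposition_constant U K}. ennreal K)"

end

theory Submission
  imports Defs "HOL-Analysis.Abstract_Topology_2"
begin

text \<open>Take \<open>A = \<ell>\<^sup>\<infinity>\<^sub>4\<close>, \<open>B = \<ell>\<^sup>\<infinity>\<^sub>2\<close> and \<open>u(a, b) = \<Sum>\<^sub>k a\<^sub>k (b\<^sub>0 + \<i>\<^sup>k b\<^sub>1)\<close>.  As both algebras are
  commutative, \<open>u\<close> and its transpose are tested by the same row and column matrices, so every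
  decomposition costs at least the value \<open>4 \<surd>2\<close> attained there.  The joint norm is the supremum of
  \<open>\<parallel>\<Sum>\<^sub>k a\<^sub>k \<otimes> (b\<^sub>0 + \<i>\<^sup>k b\<^sub>1)\<parallel>\<close> over contractive matrices, also at most \<open>4 \<surd>2\<close> by Cauchy-Schwarz.  If unit
  vectors \<open>x\<close>, \<open>y\<close> nearly attained it, then \<open>a\<^sub>k\<^sup>* x\<close> would be close to \<open>(b\<^sub>0 + \<i>\<^sup>k b\<^sub>1) y / \<surd>2\<close> and all the
  contractions nearly isometric on the relevant vectors.  Since \<open>a\<^sub>k\<close> commutes with \<open>b\<^sub>0\<close> and \<open>b\<^sub>1\<close>,
  contractivity of \<open>a\<^sub>k\<^sup>*\<close> at \<open>b\<^sub>0\<^sup>* x + \<i>\<^sup>-\<^sup>k b\<^sub>1\<^sup>* x\<close>, summed over \<open>k\<close>, then says that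
  \<open>2 \<langle>b\<^sub>0\<^sup>* b\<^sub>0 y, b\<^sub>1\<^sup>* b\<^sub>1 y\<rangle>\<close> is almost nonpositive, although it is almost \<open>2 \<parallel>y\<parallel>\<^sup>2\<close>.\<close>

section \<open>A gap for commuting contractions\<close>

definition cinner :: "'i set \<Rightarrow> ('i \<Rightarrow> complex) \<Rightarrow> ('i \<Rightarrow> complex) \<Rightarrow> complex" where
  "cinner I v w = (\<Sum>i\<in>I. cnj (v i) * w i)"

definition vnorm :: "'i set \<Rightarrow> ('i \<Rightarrow> complex) \<Rightarrow> real" where
  "vnorm I v = L2_set (\<lambda>i. cmod (v i)) I"

lemma vnorm_nonneg [simp]: "0 \<le> vnorm I v"
  by (simp add: vnorm_def)

lemma vnorm_sq: "(vnorm I v)\<^sup>2 = Re (cinner I v v)"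
  by (simp add: vnorm_def cinner_def L2_set_def sum_nonneg cmod_power2 flip: power2_eq_square)

lemma cinner_self: "cinner I v v = complex_of_real ((vnorm I v)\<^sup>2)"
proof -
  have "Im (cinner I v v) = 0" by (simp add: cinner_def mult.commute)
  then show ?thesis by (simp add: vnorm_sq complex_eq_iff)
qed

lemma cinner_commute: "cinner I v w = cnj (cinner I w v)"
  by (simp add: cinner_def mult.commute)

lemma Re_cinner_commute: "Re (cinner I v w) = Re (cinner I w v)"
  by (subst cinner_commute) simp

lemma cinner_add_right: "cinner I v (\<lambda>i. w i + z i) = cinner I v w + cinner I v z"
  by (simp add: cinner_def sum.distrib algebra_simps)

lemma cinner_diff_right: "cinner I v (\<lambda>i. w i - z i) = cinner I v w - cinner I v z"
  by (simp add: cinner_def sum_subtractf algebra_simps)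

lemma cinner_scale_right: "cinner I v (\<lambda>i. c * w i) = c * cinner I v w"
  by (simp add: cinner_def sum_distrib_left algebra_simps)

lemma cinner_add_left: "cinner I (\<lambda>i. w i + z i) v = cinner I w v + cinner I z v"
  by (simp add: cinner_def sum.distrib algebra_simps)

lemma cinner_diff_left: "cinner I (\<lambda>i. w i - z i) v = cinner I w v - cinner I z v"
  by (simp add: cinner_def sum_subtractf algebra_simps)

lemma cinner_scale_left: "cinner I (\<lambda>i. c * w i) v = cnj c * cinner I w v"
  by (simp add: cinner_def sum_distrib_left algebra_simps)

lemma cinner_sum_right: "cinner I v (\<lambda>i. \<Sum>k\<in>K. w k i) = (\<Sum>k\<in>K. cinner I v (w k))"
  by (simp add: cinner_def sum_distrib_left) (rule sum.swap)

lemmas cinner_simps = cinner_add_right cinner_diff_right cinner_scale_right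
  cinner_add_left cinner_diff_left cinner_scale_left

lemma cinner_le: "cmod (cinner I v w) \<le> vnorm I v * vnorm I w"
proof -
  have "cmod (cinner I v w) \<le> (\<Sum>i\<in>I. cmod (cnj (v i) * w i))"
    unfolding cinner_def by (rule norm_sum)
  also have "\<dots> = (\<Sum>i\<in>I. \<bar>cmod (v i)\<bar> * \<bar>cmod (w i)\<bar>)" by (simp add: norm_mult)
  also have "\<dots> \<le> vnorm I v * vnorm I w" unfolding vnorm_def by (rule L2_set_mult_ineq)
  finally show ?thesis .
qed

lemma Re_cinner_le: "\<bar>Re (cinner I v w)\<bar> \<le> vnorm I v * vnorm I w"
  using cinner_le[of I v w] abs_Re_le_cmod order_trans by blast

lemma vnorm_add_scale_sq:
  "(vnorm I (\<lambda>i. v i + c * w i))\<^sup>2 =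
     (vnorm I v)\<^sup>2 + (cmod c)\<^sup>2 * (vnorm I w)\<^sup>2 + 2 * Re (c * cinner I v w)"
proof -
  have "(vnorm I (\<lambda>i. v i + c * w i))\<^sup>2 = Re (cinner I v v + c * cinner I v w
      + cnj c * cnj (cinner I v w) + c * cnj c * cinner I w w)"
    unfolding vnorm_sq cinner_simps cinner_commute[of I w v] by (simp add: algebra_simps)
  also have "c * cnj c * cinner I w w = complex_of_real ((cmod c)\<^sup>2 * (vnorm I w)\<^sup>2)"
    by (simp only: cinner_self of_real_mult complex_norm_square)
  finally show ?thesis by (simp add: cinner_self[of I v])
qed

lemma vnorm_diff_sq:
  "(vnorm I (\<lambda>i. v i - w i))\<^sup>2 = (vnorm I v)\<^sup>2 + (vnorm I w)\<^sup>2 - 2 * Re (cinner I v w)"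
  using vnorm_add_scale_sq[of I v "-1" w] by simp

lemma vnorm_scale: "vnorm I (\<lambda>i. c * v i) = cmod c * vnorm I v"
  by (simp add: vnorm_def norm_mult L2_set_right_distrib)

lemma vnorm_triangle: "vnorm I (\<lambda>i. v i + w i) \<le> vnorm I v + vnorm I w"
proof -
  have "vnorm I (\<lambda>i. v i + w i) \<le> L2_set (\<lambda>i. cmod (v i) + cmod (w i)) I"
    unfolding vnorm_def by (rule L2_set_mono) (simp_all add: norm_triangle_ineq)
  also have "\<dots> \<le> vnorm I v + vnorm I w"
    unfolding vnorm_def by (rule L2_set_triangle_ineq)
  finally show ?thesis .
qed

text \<open>The square of the norm of \<open>T' v\<close> is the inner product of
  \<open>T (T' v)\<close> with \<open>v\<close>; Cauchy-Schwarz and one cancellation give the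
  bound.\<close>

lemma vnorm_adjoint_le:
  assumes "\<And>v w. cinner I (T v) w = cinner I v (T' w)" and "\<And>v. vnorm I (T v) \<le> c * vnorm I v"
  shows "vnorm I (T' v) \<le> c * vnorm I v"
proof (cases "vnorm I (T' v) = 0")
  case True
  have "0 \<le> c * vnorm I v" using assms(2)[of v] vnorm_nonneg[of I "T v"] by linarith
  then show ?thesis using True by simp
next
  case False
  have "(vnorm I (T' v))\<^sup>2 = Re (cinner I (T (T' v)) v)"
    by (simp add: vnorm_sq assms(1))
  also have "\<dots> \<le> vnorm I (T (T' v)) * vnorm I v" using Re_cinner_le by (smt (verit))
  also have "\<dots> \<le> c * vnorm I (T' v) * vnorm I v"
    by (intro mult_right_mono assms) simp
  finally have "vnorm I (T' v) * vnorm I (T' v) \<le> vnorm I (T' v) * (c * vnorm I v)"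
    by (simp add: power2_eq_square algebra_simps)
  then show ?thesis using False vnorm_nonneg[of I "T' v"]
    by (metis mult_le_cancel_left_pos order_le_less)
qed

text \<open>Expanding the square gives \<open>|x|^2 - 2 |T' x|^2 + |T (T' x)|^2\<close>. So if
  \<open>T'\<close> nearly preserves the norm of \<open>x\<close>, then \<open>T\<close> nearly
  undoes \<open>T'\<close> at \<open>x\<close>.\<close>

lemma vnorm_defect:
  assumes "\<And>v w. cinner I (T v) w = cinner I v (T' w)" and "\<And>v. vnorm I (T v) \<le> vnorm I v"
    and "vnorm I x \<le> 1"
  shows "(vnorm I (\<lambda>i. x i - T (T' x) i))\<^sup>2 \<le> 1 - (vnorm I (T' x))\<^sup>2"
proof -
  have "Re (cinner I x (T (T' x))) = (vnorm I (T' x))\<^sup>2"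
    by (subst cinner_commute) (simp add: assms(1) vnorm_sq)
  moreover have "(vnorm I (T (T' x)))\<^sup>2 \<le> (vnorm I (T' x))\<^sup>2"
    by (simp add: assms(2) power_mono)
  moreover have "(vnorm I x)\<^sup>2 \<le> 1" using assms(3) by (simp add: power_le_one)
  ultimately show ?thesis unfolding vnorm_diff_sq by linarith
qed

text \<open>The Cauchy-Schwarz bound is \<open>4 \<surd>2 = 16 / (2 \<surd>2)\<close>; the margin \<open>1/100\<close> is small enough for the error
  terms of the near-equality argument to stay below the contradiction.\<close>

definition gap_const :: real where
  "gap_const = (16 - 1/100) / (2 * sqrt 2)"

lemma sum_lessThan_4: "(\<Sum>k<4::nat. f k) = f 0 + f 1 + f 2 + f 3"
  by (simp add: eval_nat_numeral)

lemma cmod_i_power: "cmod (\<i> ^ k) = 1"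
  by (simp add: norm_power)

text \<open>Abstracts operators on two different tensor factors: \<open>a k\<close> on one,
  \<open>b j\<close> on the other, with primes for adjoints. Linearity is stated for the adjoints
  because the estimates expand only these on sums.\<close>

locale commuting_contractions =
  fixes I :: "'i set" and a a' :: "nat \<Rightarrow> ('i \<Rightarrow> complex) \<Rightarrow> 'i \<Rightarrow> complex"
    and b b' :: "nat \<Rightarrow> ('i \<Rightarrow> complex) \<Rightarrow> 'i \<Rightarrow> complex"
  assumes a_adjoint: "cinner I (a k v) w = cinner I v (a' k w)"
    and b_adjoint: "cinner I (b j v) w = cinner I v (b' j w)"
    and a_contraction: "k < 4 \<Longrightarrow> vnorm I (a k v) \<le> vnorm I v"
    and b_contraction: "j < 2 \<Longrightarrow> vnorm I (b j v) \<le> vnorm I v"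
    and a'_linear: "a' k (\<lambda>i. v i + c * w i) = (\<lambda>i. a' k v i + c * a' k w i)"
    and b'_linear: "b' j (\<lambda>i. v i + c * w i) = (\<lambda>i. b' j v i + c * b' j w i)"
    and commute: "a k (b' j v) = b' j (a k v)"
    and commute': "a' k (b' j v) = b' j (a' k v)"
begin

lemma a'_contraction: "k < 4 \<Longrightarrow> vnorm I (a' k v) \<le> vnorm I v"
  using vnorm_adjoint_le[of I "a k" "a' k" 1 v] a_adjoint a_contraction by simp

lemma b'_contraction: "j < 2 \<Longrightarrow> vnorm I (b' j v) \<le> vnorm I v"
  using vnorm_adjoint_le[of I "b j" "b' j" 1 v] b_adjoint b_contraction by simp

lemma b'_diff: "b' j (\<lambda>i. v i - w i) = (\<lambda>i. b' j v i - b' j w i)"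
  using b'_linear[of j v "-1" w] by simp

text \<open>Near-isometry of \<open>a' k\<close> at \<open>x\<close> passes on to
  \<open>b' j x\<close>: with \<open>w = b' j x\<close> and the defect
  \<open>r = x - a k (a' k x)\<close>, commutation turns the loss of squared norm into the inner
  product of \<open>w\<close> with \<open>b' j r\<close>, which is at most \<open>e\<close>.\<close>

lemma defect_b':
  assumes "k < 4" "j < 2" "vnorm I x \<le> 1"
    and e: "1 - (vnorm I (a' k x))\<^sup>2 \<le> e\<^sup>2" "0 \<le> e"
  shows "(vnorm I (b' j x))\<^sup>2 \<le> (vnorm I (b' j (a' k x)))\<^sup>2 + e"
proof -
  let ?w = "b' j x" and ?r = "\<lambda>i. x i - a k (a' k x) i"
  have r: "vnorm I ?r \<le> e"
  proof (rule power2_le_imp_le)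
    show "(vnorm I ?r)\<^sup>2 \<le> e\<^sup>2"
      using vnorm_defect[of I "a k" "a' k" x, OF a_adjoint a_contraction[OF assms(1)] assms(3)] e(1)
      by linarith
  qed (use e in simp)
  have "(vnorm I ?w)\<^sup>2 - (vnorm I (a' k ?w))\<^sup>2 = Re (cinner I ?w ?w) - Re (cinner I ?w (a k (a' k ?w)))"
    using a_adjoint[of k "a' k ?w" ?w] Re_cinner_commute[of I ?w "a k (a' k ?w)"]
    by (simp add: vnorm_sq)
  also have "\<dots> = Re (cinner I ?w (b' j ?r))"
    by (simp add: b'_diff cinner_simps commute commute')
  also have "\<dots> \<le> vnorm I ?w * vnorm I (b' j ?r)" using Re_cinner_le by (smt (verit))
  also have "\<dots> \<le> 1 * e"
    using b'_contraction[of j] assms(2,3) r by (intro mult_mono) (auto intro: order_trans)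
  finally show ?thesis by (simp add: commute')
qed

text \<open>If the bound failed, every inequality in the Cauchy-Schwarz estimate would be nearly
  tight. The proof then bounds the sum over \<open>k\<close> of
  \<open>Re (cnj (\<i> ^ k) * cinner I (b' 0 (p k)) (b' 1 (p k)))\<close> from both sides and finds
  the bounds incompatible.\<close>

lemma gap_inner:
  assumes x: "vnorm I x \<le> 1" and y: "vnorm I y \<le> 1"
  shows "Re (\<Sum>k<4. cinner I (a' k x) (\<lambda>i. b 0 y i + \<i> ^ k * b 1 y i)) \<le> gap_const"
proof (rule ccontr)
  assume neg: "\<not> ?thesis"
  define p where "p k = a' k x" for k
  define y0 where "y0 = b 0 y"
  define y1 where "y1 = b 1 y"
  define q where "q k = (\<lambda>i. y0 i + \<i> ^ k * y1 i)" for k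
  \<comment> \<open>The residual of the equality case \<open>q k = sqrt 2 * p k\<close>. The factor
    fits the sizes: \<open>|p k|\<close> is at most 1, while \<open>|q k|^2\<close> averages to at
    most 2 over \<open>k\<close>.\<close>
  define d where "d k = (\<lambda>i. complex_of_real (sqrt 2) * p k i - q k i)" for k
  have p_le: "vnorm I (p k) \<le> 1" if "k < 4" for k
    using a'_contraction[OF that, of x] x by (simp add: p_def)
  have y0_le: "vnorm I y0 \<le> vnorm I y" and y1_le: "vnorm I y1 \<le> vnorm I y"
    using b_contraction by (simp_all add: y0_def y1_def)
  have d_sq: "(vnorm I (d k))\<^sup>2 = 2 * (vnorm I (p k))\<^sup>2 + (vnorm I (q k))\<^sup>2
      - 2 * sqrt 2 * Re (cinner I (p k) (q k))" for k
    by (simp add: d_def vnorm_diff_sq vnorm_scale cinner_scale_left power_mult_distrib)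
  have q_sq: "(vnorm I (q k))\<^sup>2 = (vnorm I y0)\<^sup>2 + (vnorm I y1)\<^sup>2 + 2 * Re (\<i> ^ k * cinner I y0 y1)" for k
    by (simp add: q_def vnorm_add_scale_sq cmod_i_power)
  have i3: "\<i> ^ 3 = - \<i>" by (simp add: eval_nat_numeral)
  \<comment> \<open>The cross terms carry the weights \<open>\<i> ^ k\<close>, and these sum to 0
    over \<open>k < 4\<close>.\<close>
  have q_sum: "(\<Sum>k<4. (vnorm I (q k))\<^sup>2) = 4 * (vnorm I y0)\<^sup>2 + 4 * (vnorm I y1)\<^sup>2"
    unfolding q_sq sum_lessThan_4 by (simp add: i3)
  have "gap_const < Re (\<Sum>k<4. cinner I (p k) (q k))"
    using neg by (simp add: p_def q_def y0_def y1_def)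
  then have "2 * sqrt 2 * gap_const < 2 * sqrt 2 * (\<Sum>k<4. Re (cinner I (p k) (q k)))" by simp
  also have "\<dots> = (\<Sum>k<4. 2 * (vnorm I (p k))\<^sup>2 + (vnorm I (q k))\<^sup>2 - (vnorm I (d k))\<^sup>2)"
    by (simp add: d_sq sum_distrib_left)
  also have "\<dots> = (\<Sum>k<4. 2 * (vnorm I (p k))\<^sup>2) + 4 * (vnorm I y0)\<^sup>2 + 4 * (vnorm I y1)\<^sup>2
      - (\<Sum>k<4. (vnorm I (d k))\<^sup>2)"
    by (simp add: sum.distrib sum_subtractf q_sum)
  finally have big: "16 - 1/100 < (\<Sum>k<4. 2 * (vnorm I (p k))\<^sup>2) + 4 * (vnorm I y0)\<^sup>2
      + 4 * (vnorm I y1)\<^sup>2 - (\<Sum>k<4. (vnorm I (d k))\<^sup>2)"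
    by (simp add: gap_const_def)
  have ysq: "(vnorm I y)\<^sup>2 \<le> 1" "(vnorm I y0)\<^sup>2 \<le> 1" "(vnorm I y1)\<^sup>2 \<le> 1"
    using y y0_le y1_le by (simp_all add: power_le_one)
  have psq: "(vnorm I (p k))\<^sup>2 \<le> 1" if "k < 4" for k
    using p_le[OF that] by (simp add: power_le_one)
  \<comment> \<open>the \<open>k\<close>-th share of the deficit in Cauchy-Schwarz; the total deficit is at most \<open>1/100\<close>\<close>
  define D where "D k = 2 - 2 * (vnorm I (p k))\<^sup>2 + (vnorm I (d k))\<^sup>2" for k
  have D_nonneg: "0 \<le> D k" if "k < 4" for k using psq[OF that] by (simp add: D_def)
  have "(\<Sum>k<4. D k) = 8 - (\<Sum>k<4. 2 * (vnorm I (p k))\<^sup>2) + (\<Sum>k<4. (vnorm I (d k))\<^sup>2)"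
    by (simp add: D_def sum.distrib sum_subtractf algebra_simps)
  with big have D_sum: "(\<Sum>k<4. D k) + 8 - 4 * (vnorm I y0)\<^sup>2 - 4 * (vnorm I y1)\<^sup>2 \<le> 1/100"
    by linarith
  \<comment> \<open>All \<open>D k\<close> are nonnegative, so each is at most the total deficit
    \<open>1/100\<close>; the second bound is half of that because \<open>D k\<close> contains
    \<open>2 * (1 - |p k|^2)\<close>.\<close>
  have small: "(vnorm I (d k))\<^sup>2 \<le> 1/100 \<and> 1 - (vnorm I (p k))\<^sup>2 \<le> 1/200" if "k < 4" for k
  proof -
    have "D k \<le> (\<Sum>k<4. D k)" using that D_nonneg by (intro member_le_sum) auto
    then have "D k \<le> 1/100" using D_sum ysq by linarith
    moreover have "0 \<le> (vnorm I (d k))\<^sup>2" by simp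
    ultimately show ?thesis using psq[OF that] unfolding D_def by (intro conjI; linarith)
  qed
  have "0 \<le> (\<Sum>k<4. D k)" using D_nonneg by (intro sum_nonneg) auto
  then have small_y: "1 - (vnorm I y0)\<^sup>2 \<le> 1/400" "1 - (vnorm I y1)\<^sup>2 \<le> 1/400"
    using D_sum ysq by linarith+
  have d_le: "vnorm I (d k) \<le> 1/10" if "k < 4" for k
    by (rule power2_le_imp_le) (use small[OF that] in \<open>simp_all add: power2_eq_square\<close>)
  let ?w = "\<lambda>j. b' j x"
  have lin: "a' k (\<lambda>i. ?w 0 i + c * ?w 1 i) = (\<lambda>i. b' 0 (p k) i + c * b' 1 (p k) i)" for k c
    by (simp add: a'_linear commute' p_def)
  \<comment> \<open>the squared norms cancel up to the isometry defect of \<open>a' k\<close>, which leaves the cross terms\<close>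
  have upper: "2 * Re (cnj (\<i> ^ k) * cinner I (b' 0 (p k)) (b' 1 (p k)))
      \<le> 3/20 + 2 * Re (cnj (\<i> ^ k) * cinner I (?w 0) (?w 1))" if "k < 4" for k
  proof -
    have "vnorm I (\<lambda>i. b' 0 (p k) i + cnj (\<i> ^ k) * b' 1 (p k) i)
        \<le> vnorm I (\<lambda>i. ?w 0 i + cnj (\<i> ^ k) * ?w 1 i)"
      using a'_contraction[OF that, of "\<lambda>i. ?w 0 i + cnj (\<i> ^ k) * ?w 1 i"] by (simp only: lin)
    then have "(vnorm I (\<lambda>i. b' 0 (p k) i + cnj (\<i> ^ k) * b' 1 (p k) i))\<^sup>2
        \<le> (vnorm I (\<lambda>i. ?w 0 i + cnj (\<i> ^ k) * ?w 1 i))\<^sup>2"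
      by (simp add: power_mono)
    \<comment> \<open>\<open>3/40\<close> is a rational bound for the square root of
      \<open>1/200\<close>, as \<open>(3/40)^2 = 9/1600\<close>.\<close>
    moreover have "(vnorm I (?w j))\<^sup>2 \<le> (vnorm I (b' j (p k)))\<^sup>2 + 3/40" if "j < 2" for j
      using defect_b'[OF \<open>k < 4\<close> that x, of "3/40"] small[OF \<open>k < 4\<close>]
      by (simp add: p_def power2_eq_square)
    from this[of 0] this[of 1] have "(vnorm I (?w 0))\<^sup>2 + (vnorm I (?w 1))\<^sup>2
        \<le> (vnorm I (b' 0 (p k)))\<^sup>2 + (vnorm I (b' 1 (p k)))\<^sup>2 + 3/20" by simp
    ultimately show ?thesis
      by (simp add: vnorm_add_scale_sq cmod_i_power del: complex_cnj_power)
  qed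
  \<comment> \<open>The terms in \<open>?w\<close> cancel, since \<open>cnj (\<i> ^ k)\<close> sums
    to 0; what remains is half of \<open>4 * 3/20\<close>.\<close>
  have sum_upper: "(\<Sum>k<4. Re (cnj (\<i> ^ k) * cinner I (b' 0 (p k)) (b' 1 (p k)))) \<le> 3/10"
    using upper[of 0] upper[of 1] upper[of 2] upper[of 3]
    by (simp add: sum_lessThan_4 i3)
  \<comment> \<open>Replaces \<open>sqrt 2 * p k\<close> by \<open>q k\<close> in both arguments.
    Each replacement costs \<open>|d k| \<le> 1/10\<close> times the norm of the other argument, at
    most \<open>3/2\<close> and \<open>2\<close>, hence \<open>3/20 + 1/5 = 7/20\<close>.\<close>
  have lower: "Re (cnj (\<i> ^ k) * cinner I (b' 0 (q k)) (b' 1 (q k))) - 7/20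
      \<le> 2 * Re (cnj (\<i> ^ k) * cinner I (b' 0 (p k)) (b' 1 (p k)))" if "k < 4" for k
  proof -
    let ?s = "\<lambda>i. complex_of_real (sqrt 2) * p k i"
    have q_le: "vnorm I (q k) \<le> 2"
    proof -
      have "vnorm I (q k) \<le> vnorm I y0 + vnorm I (\<lambda>i. \<i> ^ k * y1 i)"
        unfolding q_def by (rule vnorm_triangle)
      then show ?thesis using y0_le y1_le y by (simp add: vnorm_scale cmod_i_power)
    qed
    have s_le: "vnorm I ?s \<le> 3/2"
    proof -
      have "sqrt 2 \<le> 3/2" by (rule real_le_lsqrt) (simp_all add: power2_eq_square)
      then show ?thesis using mult_mono[of "sqrt 2" "3/2" "vnorm I (p k)" 1] p_le[OF that]
        by (simp add: vnorm_scale)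
    qed
    have b'_s: "b' j ?s = (\<lambda>i. complex_of_real (sqrt 2) * b' j (p k) i)" for j
    proof -
      \<comment> \<open>\<open>b'_linear\<close> speaks of sums \<open>v + c w\<close> only. The
        case \<open>c = -1\<close> at zero vectors gives \<open>b' j 0 = 0\<close>, and then
        \<open>v = 0\<close> gives homogeneity.\<close>
      have "b' j (\<lambda>i. 0) = (\<lambda>i. 0)" using b'_linear[of j "\<lambda>i. 0" "-1" "\<lambda>i. 0"] by (auto simp: fun_eq_iff)
      then show ?thesis using b'_linear[of j "\<lambda>i. 0" "complex_of_real (sqrt 2)" "p k"] by simp
    qed
    have b'_d: "b' j (d k) = (\<lambda>i. b' j ?s i - b' j (q k) i)" for j
      unfolding d_def by (rule b'_diff)
    have "cinner I (b' 0 ?s) (b' 1 ?s) - cinner I (b' 0 (q k)) (b' 1 (q k))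
        = cinner I (b' 0 (d k)) (b' 1 ?s) + cinner I (b' 0 (q k)) (b' 1 (d k))"
      unfolding b'_d cinner_diff_left cinner_diff_right by simp
    also have "cmod \<dots> \<le> cmod (cinner I (b' 0 (d k)) (b' 1 ?s)) + cmod (cinner I (b' 0 (q k)) (b' 1 (d k)))"
      by (rule norm_triangle_ineq)
    also have "\<dots> \<le> vnorm I (b' 0 (d k)) * vnorm I (b' 1 ?s) + vnorm I (b' 0 (q k)) * vnorm I (b' 1 (d k))"
      by (intro add_mono cinner_le)
    also have "\<dots> \<le> (1/10) * (3/2) + 2 * (1/10)"
    proof (intro add_mono mult_mono)
      show "vnorm I (b' 0 (d k)) \<le> 1/10" "vnorm I (b' 1 (d k)) \<le> 1/10"
        using b'_contraction[of _ "d k"] d_le[OF that] by (meson order_trans one_less_numeral_iff pos2 semiring_norm(76))+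
      show "vnorm I (b' 1 ?s) \<le> 3/2" "vnorm I (b' 0 (q k)) \<le> 2"
        using b'_contraction[of 1 ?s] b'_contraction[of 0 "q k"] s_le q_le by auto
    qed simp_all
    finally have "cmod (cinner I (b' 0 ?s) (b' 1 ?s) - cinner I (b' 0 (q k)) (b' 1 (q k))) \<le> 7/20"
      by simp
    moreover have "cinner I (b' 0 ?s) (b' 1 ?s) = 2 * cinner I (b' 0 (p k)) (b' 1 (p k))"
      by (simp add: b'_s cinner_simps flip: of_real_mult mult.assoc)
    ultimately have "cmod (cnj (\<i> ^ k) * (2 * cinner I (b' 0 (p k)) (b' 1 (p k))
        - cinner I (b' 0 (q k)) (b' 1 (q k)))) \<le> 7/20"
      by (simp add: norm_mult cmod_i_power norm_power)
    then have "\<bar>Re (cnj (\<i> ^ k) * (2 * cinner I (b' 0 (p k)) (b' 1 (p k))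
        - cinner I (b' 0 (q k)) (b' 1 (q k))))\<bar> \<le> 7/20"
      using abs_Re_le_cmod order_trans by blast
    moreover have "Re (c * (2 * P - Q)) = 2 * Re (c * P) - Re (c * Q)" for c P Q
      by (simp add: algebra_simps)
    ultimately show ?thesis by (simp only: abs_le_iff) linarith
  qed
  let ?g = "\<lambda>j. b' j (b j y)"
  have "b' j (q k) = (\<lambda>i. b' j y0 i + \<i> ^ k * b' j y1 i)" for j k
    unfolding q_def by (rule b'_linear)
  \<comment> \<open>Of the four products only the one pairing \<open>b' 0 y0\<close> with
    \<open>b' 1 y1\<close> has weight 1 for every \<open>k\<close>; the weights of the others sum to
    0.\<close>
  then have sum_q: "(\<Sum>k<4. Re (cnj (\<i> ^ k) * cinner I (b' 0 (q k)) (b' 1 (q k))))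
      = 4 * Re (cinner I (b' 0 y0) (b' 1 y1))"
    by (simp add: sum_lessThan_4 cinner_simps i3 algebra_simps)
  \<comment> \<open>\<open>vnorm_defect\<close> with the roles exchanged: \<open>b j\<close> nearly
    preserves the norm of \<open>y\<close>, so \<open>b' j\<close> nearly undoes it;
    \<open>(1/20)^2 = 1/400\<close>.\<close>
  have near: "vnorm I (\<lambda>i. y i - b' j (b j y) i) \<le> 1/20" if "j < 2" "1 - (vnorm I (b j y))\<^sup>2 \<le> 1/400" for j
  proof (rule power2_le_imp_le)
    have adj: "cinner I (b' j v) w = cinner I v (b j w)" for v w
      by (subst cinner_commute) (simp add: b_adjoint flip: cinner_commute)
    show "(vnorm I (\<lambda>i. y i - b' j (b j y) i))\<^sup>2 \<le> (1/20)\<^sup>2"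
      using vnorm_defect[of I "b' j" "b j" y, OF adj b'_contraction[OF that(1)] y] that(2)
      by (simp add: power2_eq_square)
  qed simp
  define e0 where "e0 = (\<lambda>i. y i - b' 0 y0 i)"
  define e1 where "e1 = (\<lambda>i. y i - b' 1 y1 i)"
  have e_le: "vnorm I e0 \<le> 1/20" "vnorm I e1 \<le> 1/20"
    using near[of 0] near[of 1] small_y by (simp_all add: e0_def e1_def y0_def y1_def)
  have "cinner I (b' 0 y0) (b' 1 y1) = cinner I y y - cinner I y e1 - cinner I e0 (b' 1 y1)"
    by (simp add: e0_def e1_def cinner_simps)
  moreover have "Re (cinner I y e1) \<le> 1/20"
    using Re_cinner_le[of I y e1] mult_mono[of "vnorm I y" 1 "vnorm I e1" "1/20"] y e_le by simp
  moreover have "vnorm I (b' 1 y1) \<le> 1" using b'_contraction[of 1 y1] y1_le y by simp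
  then have "Re (cinner I e0 (b' 1 y1)) \<le> 1/20"
    using Re_cinner_le[of I e0 "b' 1 y1"] mult_mono[of "vnorm I e0" "1/20" "vnorm I (b' 1 y1)" 1] e_le by simp
  moreover have "(vnorm I y0)\<^sup>2 \<le> (vnorm I y)\<^sup>2" using y0_le by (simp add: power_mono)
  then have "399/400 \<le> Re (cinner I y y)" unfolding vnorm_sq[symmetric] using small_y by linarith
  ultimately have "4 * (399/400 - 1/10) \<le> 4 * Re (cinner I (b' 0 y0) (b' 1 y1))" by simp
  moreover have "4 * Re (cinner I (b' 0 y0) (b' 1 y1)) - 7/5 \<le> 3/5"
    using lower[of 0] lower[of 1] lower[of 2] lower[of 3] sum_upper
    unfolding sum_q[symmetric] sum_lessThan_4 by simp
  \<comment> \<open>The same quantity is at least \<open>3.59\<close> and at most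
    \<open>7/5 + 3/5 = 2\<close>.\<close>
  ultimately show False by simp
qed

text \<open>Duality: pairing the vector with its own normalization \<open>x\<close> recovers its
  norm, and moving each \<open>a k\<close> over to \<open>x\<close> yields the expression in
  \<open>gap_inner\<close>.\<close>

lemma gap_norm:
  assumes y: "vnorm I y \<le> 1"
  shows "vnorm I (\<lambda>i. \<Sum>k<4. a k (\<lambda>i. b 0 y i + \<i> ^ k * b 1 y i) i) \<le> gap_const"
    (is "vnorm I ?z \<le> _")
proof (cases "vnorm I ?z = 0")
  case True
  then show ?thesis by (simp add: gap_const_def)
next
  case False
  then have pos: "0 < vnorm I ?z" by (simp add: order_less_le)
  define x where "x = (\<lambda>i. complex_of_real (1 / vnorm I ?z) * ?z i)"
  have x: "vnorm I x = 1" unfolding x_def vnorm_scale norm_of_real using pos by simp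
  have adj: "cinner I x (a k v) = cinner I (a' k x) v" for k v
    by (subst cinner_commute) (simp add: a_adjoint flip: cinner_commute)
  have "cinner I x ?z = complex_of_real (vnorm I ?z)"
    unfolding x_def cinner_scale_left cinner_self using pos
    by (simp add: power2_eq_square)
  then have "vnorm I ?z = Re (cinner I x ?z)" by simp
  also have "\<dots> = Re (\<Sum>k<4. cinner I (a' k x) (\<lambda>i. b 0 y i + \<i> ^ k * b 1 y i))"
    by (simp only: cinner_sum_right adj)
  also have "\<dots> \<le> gap_const" using gap_inner x y by simp
  finally show ?thesis .
qed

end


section \<open>Direct sums of matrix algebras and uniqueness of their norms\<close>

definition mv :: "'i set \<Rightarrow> ('i \<Rightarrow> 'i \<Rightarrow> complex) \<Rightarrow> ('i \<Rightarrow> complex) \<Rightarrow> 'i \<Rightarrow> complex" where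
  "mv I M v = (\<lambda>r. \<Sum>s\<in>I. M r s * v s)"

definition madj :: "('i \<Rightarrow> 'i \<Rightarrow> complex) \<Rightarrow> 'i \<Rightarrow> 'i \<Rightarrow> complex" where
  "madj M = (\<lambda>r s. cnj (M s r))"

lemma cinner_mv_left: "cinner I (mv I M v) w = cinner I v (mv I (madj M) w)"
  unfolding cinner_def mv_def madj_def cnj_sum sum_distrib_left sum_distrib_right
  by (subst sum.swap) (simp add: algebra_simps)

lemma madj_madj [simp]: "madj (madj M) = M"
  by (simp add: madj_def)

lemma mv_add_scale: "mv I M (\<lambda>i. v i + c * w i) = (\<lambda>i. mv I M v i + c * mv I M w i)"
  by (simp add: mv_def sum.distrib sum_distrib_left algebra_simps)

lemma vnorm_cong: "(\<And>i. i \<in> I \<Longrightarrow> v i = w i) \<Longrightarrow> vnorm I v = vnorm I w"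
  unfolding vnorm_def by (rule L2_set_cong) simp_all

lemma cmod_le_vnorm: "finite I \<Longrightarrow> i \<in> I \<Longrightarrow> cmod (v i) \<le> vnorm I v"
  unfolding vnorm_def by (rule member_le_L2_set)

text \<open>A family \<open>F\<close> stands for the block diagonal operator with blocks \<open>F i\<close> (\<open>i < n\<close>) of size \<open>m\<close>.\<close>

definition block_bound :: "nat \<Rightarrow> nat \<Rightarrow> (nat \<Rightarrow> nat \<Rightarrow> nat \<Rightarrow> complex) \<Rightarrow> real \<Rightarrow> bool" where
  "block_bound n m F c \<longleftrightarrow>
     0 \<le> c \<and> (\<forall>i<n. \<forall>v. vnorm {..<m} (mv {..<m} (F i) v) \<le> c * vnorm {..<m} v)"

text \<open>The operator norm of the block diagonal operator, that is, the largest operator norm of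
  a block. The infimum over bounds also gives 0 when there are no blocks or the blocks are
  empty.\<close>

definition block_norm :: "nat \<Rightarrow> nat \<Rightarrow> (nat \<Rightarrow> nat \<Rightarrow> nat \<Rightarrow> complex) \<Rightarrow> real" where
  "block_norm n m F = Inf {c. block_bound n m F c}"

text \<open>A crude bound by the sum of all moduli. It shows that the infimum in
  \<open>block_norm\<close> is over a nonempty set, and later turns entrywise estimates into norm
  estimates.\<close>

lemma block_bound_sum: "block_bound n m F (\<Sum>i<n. \<Sum>r<m. \<Sum>s<m. cmod (F i r s))"
  unfolding block_bound_def
proof (intro conjI allI impI)
  fix i v assume i: "i < n"
  have "vnorm {..<m} (mv {..<m} (F i) v) \<le> (\<Sum>r<m. cmod (mv {..<m} (F i) v r))"
    unfolding vnorm_def by (rule L2_set_le_sum) simp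
  also have "\<dots> \<le> (\<Sum>r<m. \<Sum>s<m. cmod (F i r s) * vnorm {..<m} v)"
    unfolding mv_def
    by (intro sum_mono order_trans[OF norm_sum])
       (auto simp: norm_mult cmod_le_vnorm intro!: mult_left_mono)
  also have "\<dots> = (\<Sum>r<m. \<Sum>s<m. cmod (F i r s)) * vnorm {..<m} v"
    by (simp add: sum_distrib_right)
  also have "\<dots> \<le> (\<Sum>i<n. \<Sum>r<m. \<Sum>s<m. cmod (F i r s)) * vnorm {..<m} v"
    using i by (intro mult_right_mono member_le_sum) (auto simp: sum_nonneg)
  finally show "vnorm {..<m} (mv {..<m} (F i) v) \<le> \<dots>" .
qed (simp add: sum_nonneg)

lemma block_norm_le: "block_bound n m F c \<Longrightarrow> block_norm n m F \<le> c"
  unfolding block_norm_def by (rule cInf_lower) (auto simp: block_bound_def intro: bdd_belowI[of _ 0])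

lemma block_norm_nonneg: "0 \<le> block_norm n m F"
  unfolding block_norm_def using block_bound_sum[of n m F]
  by (intro cInf_greatest) (auto simp: block_bound_def)

lemma block_norm_mv:
  assumes "i < n"
  shows "vnorm {..<m} (mv {..<m} (F i) v) \<le> block_norm n m F * vnorm {..<m} v"
proof (cases "vnorm {..<m} v = 0")
  case True
  have "vnorm {..<m} (mv {..<m} (F i) v) \<le> (\<Sum>i<n. \<Sum>r<m. \<Sum>s<m. cmod (F i r s)) * vnorm {..<m} v"
    using block_bound_sum[of n m F] assms unfolding block_bound_def by blast
  then show ?thesis using True by simp
next
  case False
  then have pos: "0 < vnorm {..<m} v" by (simp add: order_less_le)
  have "vnorm {..<m} (mv {..<m} (F i) v) / vnorm {..<m} v \<le> block_norm n m F"
    unfolding block_norm_def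
  proof (rule cInf_greatest)
    show "{c. block_bound n m F c} \<noteq> {}" using block_bound_sum by blast
  qed (use assms pos in \<open>auto simp: block_bound_def pos_divide_le_eq\<close>)
  then show ?thesis using pos by (simp add: pos_divide_le_eq)
qed

lemma block_bound_norm: "block_bound n m F (block_norm n m F)"
  by (simp add: block_bound_def block_norm_nonneg block_norm_mv)

lemma block_bound_mono: "block_bound n m F c \<Longrightarrow> c \<le> d \<Longrightarrow> block_bound n m F d"
  unfolding block_bound_def by (meson mult_right_mono order_trans vnorm_nonneg)

lemma block_norm_le_iff: "0 \<le> c \<Longrightarrow> block_norm n m F \<le> c \<longleftrightarrow> block_bound n m F c"
  using block_norm_le block_bound_norm block_bound_mono by blast

lemma block_bound_cong:
  assumes "\<And>i r s. \<lbrakk>i < n; r < m; s < m\<rbrakk> \<Longrightarrow> F i r s = G i r s"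
  shows "block_bound n m F c = block_bound n m G c"
proof -
  have "vnorm {..<m} (mv {..<m} (F i) v) = vnorm {..<m} (mv {..<m} (G i) v)" if "i < n" for i v
    by (rule vnorm_cong) (simp add: mv_def assms that)
  then show ?thesis by (simp add: block_bound_def)
qed

lemma block_norm_cong:
  assumes "\<And>i r s. \<lbrakk>i < n; r < m; s < m\<rbrakk> \<Longrightarrow> F i r s = G i r s"
  shows "block_norm n m F = block_norm n m G"
proof -
  have "block_bound n m F = block_bound n m G" by (intro ext block_bound_cong assms)
  then show ?thesis by (simp add: block_norm_def)
qed

text \<open>Applying the block to the standard basis vector at \<open>s\<close> produces its column
  \<open>s\<close>.\<close>

lemma cmod_le_block_norm:
  assumes "i < n" "r < m" "s < m"
  shows "cmod (F i r s) \<le> block_norm n m F"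
proof -
  let ?v = "\<lambda>t. if t = s then 1 else 0"
  have "mv {..<m} (F i) ?v r = F i r s" using assms by (simp add: mv_def if_distrib cong: if_cong)
  then have "cmod (F i r s) \<le> vnorm {..<m} (mv {..<m} (F i) ?v)"
    using cmod_le_vnorm[of "{..<m}" r "mv {..<m} (F i) ?v"] assms by simp
  also have "\<dots> \<le> block_norm n m F * vnorm {..<m} ?v" by (rule block_norm_mv) fact
  also have "vnorm {..<m} ?v = 1"
    using assms by (simp add: vnorm_def L2_set_def if_distrib if_distribR cong: if_cong)
  finally show ?thesis by simp
qed

lemma block_norm_eq_0_iff:
  "block_norm n m F = 0 \<longleftrightarrow> (\<forall>i<n. \<forall>r<m. \<forall>s<m. F i r s = 0)"
proof
  assume "block_norm n m F = 0"
  then show "\<forall>i<n. \<forall>r<m. \<forall>s<m. F i r s = 0" using cmod_le_block_norm[of _ n _ m _ F] by fastforce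
next
  assume "\<forall>i<n. \<forall>r<m. \<forall>s<m. F i r s = 0"
  then have "(\<Sum>i<n. \<Sum>r<m. \<Sum>s<m. cmod (F i r s)) = 0" by simp
  then show "block_norm n m F = 0"
    using block_norm_le[OF block_bound_sum[of n m F]] block_norm_nonneg[of n m F] by simp
qed

lemma block_norm_add: "block_norm n m (\<lambda>i r s. F i r s + G i r s) \<le> block_norm n m F + block_norm n m G"
proof (rule block_norm_le, unfold block_bound_def, intro conjI allI impI)
  fix i v assume i: "i < n"
  have "mv {..<m} (\<lambda>r s. F i r s + G i r s) v = (\<lambda>r. mv {..<m} (F i) v r + mv {..<m} (G i) v r)"
    by (simp add: mv_def sum.distrib algebra_simps)
  then show "vnorm {..<m} (mv {..<m} (\<lambda>r s. F i r s + G i r s) v)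
      \<le> (block_norm n m F + block_norm n m G) * vnorm {..<m} v"
    using vnorm_triangle[of "{..<m}" "mv {..<m} (F i) v" "mv {..<m} (G i) v"]
      block_norm_mv[OF i, of m F v] block_norm_mv[OF i, of m G v] by (simp add: algebra_simps)
qed (simp add: block_norm_nonneg)

lemma block_norm_scale: "block_norm n m (\<lambda>i r s. c * F i r s) = cmod c * block_norm n m F"
proof -
  have le: "block_norm n m (\<lambda>i r s. c * F i r s) \<le> cmod c * block_norm n m F" for c F
  proof (rule block_norm_le, unfold block_bound_def, intro conjI allI impI)
    fix i v assume i: "i < n"
    have "mv {..<m} (\<lambda>r s. c * F i r s) v = (\<lambda>r. c * mv {..<m} (F i) v r)"
      by (simp add: mv_def sum_distrib_left algebra_simps)
    then show "vnorm {..<m} (mv {..<m} (\<lambda>r s. c * F i r s) v) \<le> cmod c * block_norm n m F * vnorm {..<m} v"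
      using block_norm_mv[OF i, of m F v] by (simp add: vnorm_scale mult.assoc mult_left_mono)
  qed (simp add: block_norm_nonneg)
  show ?thesis
  proof (cases "c = 0")
    case True
    then show ?thesis using block_norm_eq_0_iff[of n m "\<lambda>i r s. 0"] by simp
  next
    case False
    then have "block_norm n m F = block_norm n m (\<lambda>i r s. inverse c * (c * F i r s))"
      by (simp flip: mult.assoc)
    also have "\<dots> \<le> cmod (inverse c) * block_norm n m (\<lambda>i r s. c * F i r s)" by (rule le)
    finally have "cmod c * block_norm n m F \<le> block_norm n m (\<lambda>i r s. c * F i r s)"
      using False by (simp add: norm_divide field_simps)
    then show ?thesis using le[of c F] by simp
  qed
qed

lemma block_norm_mult:
  "block_norm n m (\<lambda>i r s. \<Sum>t<m. F i r t * G i t s) \<le> block_norm n m F * block_norm n m G"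
proof (rule block_norm_le, unfold block_bound_def, intro conjI allI impI)
  fix i v assume i: "i < n"
  have "mv {..<m} (\<lambda>r s. \<Sum>t<m. F i r t * G i t s) v = mv {..<m} (F i) (mv {..<m} (G i) v)"
    unfolding mv_def sum_distrib_left sum_distrib_right by (subst sum.swap) (simp add: algebra_simps)
  then have "vnorm {..<m} (mv {..<m} (\<lambda>r s. \<Sum>t<m. F i r t * G i t s) v)
      \<le> block_norm n m F * vnorm {..<m} (mv {..<m} (G i) v)"
    using block_norm_mv[OF i] by simp
  also have "\<dots> \<le> block_norm n m F * (block_norm n m G * vnorm {..<m} v)"
    by (intro mult_left_mono block_norm_mv i block_norm_nonneg)
  finally show "vnorm {..<m} (mv {..<m} (\<lambda>r s. \<Sum>t<m. F i r t * G i t s) v)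
      \<le> block_norm n m F * block_norm n m G * vnorm {..<m} v" by (simp add: algebra_simps)
qed (simp add: block_norm_nonneg)

lemma block_norm_adj: "block_norm n m (\<lambda>i. madj (F i)) = block_norm n m F"
proof -
  have le: "block_norm n m (\<lambda>i. madj (F i)) \<le> block_norm n m F" for F
    by (rule block_norm_le)
       (auto simp: block_bound_def block_norm_nonneg intro: vnorm_adjoint_le[OF cinner_mv_left] block_norm_mv)
  from le[of F] le[of "\<lambda>i. madj (F i)"] show ?thesis by simp
qed

text \<open>For the nontrivial direction, \<open>|T v|^2\<close> is the inner product of
  \<open>v\<close> with \<open>T* T v\<close>, hence at most the norm of \<open>T* T\<close> times
  \<open>|v|^2\<close>.\<close>

lemma block_norm_cstar:
  "block_norm n m (\<lambda>i r s. \<Sum>t<m. madj (F i) r t * F i t s) = (block_norm n m F)\<^sup>2" (is "?L = _")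
proof (rule antisym)
  show "?L \<le> (block_norm n m F)\<^sup>2"
    using block_norm_mult[of n m "\<lambda>i. madj (F i)" F] by (simp add: block_norm_adj power2_eq_square)
  have "block_norm n m F \<le> sqrt ?L"
  proof (rule block_norm_le, unfold block_bound_def, intro conjI allI impI)
    fix i v assume i: "i < n"
    let ?T = "mv {..<m} (F i)" and ?G = "\<lambda>i r s. \<Sum>t<m. madj (F i) r t * F i t s"
    have "mv {..<m} (?G i) v = mv {..<m} (madj (F i)) (?T v)"
      unfolding mv_def sum_distrib_left sum_distrib_right by (subst sum.swap) (simp add: algebra_simps)
    then have "(vnorm {..<m} (?T v))\<^sup>2 = Re (cinner {..<m} v (mv {..<m} (?G i) v))"
      by (simp add: vnorm_sq cinner_mv_left)
    also have "\<dots> \<le> vnorm {..<m} v * vnorm {..<m} (mv {..<m} (?G i) v)"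
      using Re_cinner_le by (rule order_trans[OF abs_ge_self])
    also have "\<dots> \<le> vnorm {..<m} v * (?L * vnorm {..<m} v)"
      using block_norm_mv[OF i, of m ?G v] by (intro mult_left_mono) simp_all
    also have "\<dots> = (sqrt ?L * vnorm {..<m} v)\<^sup>2"
      by (simp add: power_mult_distrib block_norm_nonneg) (simp add: power2_eq_square)
    finally show "vnorm {..<m} (?T v) \<le> sqrt ?L * vnorm {..<m} v"
      by (rule power2_le_imp_le) (simp add: block_norm_nonneg)
  qed (simp add: block_norm_nonneg)
  then have "(block_norm n m F)\<^sup>2 \<le> (sqrt ?L)\<^sup>2" by (intro power_mono block_norm_nonneg)
  then show "(block_norm n m F)\<^sup>2 \<le> ?L" by (simp add: block_norm_nonneg)
qed

section \<open>Uniqueness of the C*-norm on a direct sum of matrix algebras\<close>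

lemma le_of_power_le:
  fixes a b C :: real
  assumes "0 \<le> a" "0 \<le> b" and le: "\<And>k. a ^ 2 ^ Suc k \<le> C * b ^ 2 ^ Suc k"
  shows "a \<le> b"
proof (rule ccontr)
  assume "\<not> a \<le> b"
  then have ab: "b < a" by simp
  show False
  proof (cases "b = 0")
    case True
    then have "a ^ 2 ^ Suc 0 \<le> 0" using le[of 0] by simp
    then show False using ab True by simp
  next
    case False
    then have b: "0 < b" using assms by simp
    then have t: "1 < a / b" using ab by simp
    \<comment> \<open>Powers of the ratio \<open>a / b > 1\<close> exceed every constant. The
      hypothesis covers only the exponents \<open>2 ^ Suc k\<close> produced by repeated squaring,
      but these dominate \<open>k\<close>.\<close>
    obtain k where k: "C < (a / b) ^ k" using real_arch_pow[OF t] by blast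
    have "k \<le> 2 ^ Suc k" using less_exp[of "Suc k"] by linarith
    then have "(a / b) ^ k \<le> (a / b) ^ 2 ^ Suc k" using t by (intro power_increasing) auto
    also have "\<dots> \<le> C" using le[of k] b by (simp add: power_divide pos_divide_le_eq)
    finally show False using k by simp
  qed
qed

text \<open>The *-algebra \<open>S\<close> is identified with a direct sum of \<open>n\<close> copies of the \<open>m \<times> m\<close> matrices;
  \<open>\<pi> x i r s\<close> is the entry \<open>(r, s)\<close> of the \<open>i\<close>-th block of \<open>x\<close>.\<close>

locale block_rep =
  fixes n m :: nat and S :: "'b cstar_struct" (structure)
    and \<pi> :: "'b \<Rightarrow> nat \<Rightarrow> nat \<Rightarrow> nat \<Rightarrow> complex"
  assumes zero_closed: "\<zero> \<in> carrier S"
    and add_closed: "\<lbrakk>x \<in> carrier S; y \<in> carrier S\<rbrakk> \<Longrightarrow> x \<oplus> y \<in> carrier S"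
    and smult_closed: "x \<in> carrier S \<Longrightarrow> c \<odot> x \<in> carrier S"
    and mult_closed: "\<lbrakk>x \<in> carrier S; y \<in> carrier S\<rbrakk> \<Longrightarrow> x \<otimes> y \<in> carrier S"
    and star_closed: "x \<in> carrier S \<Longrightarrow> star S x \<in> carrier S"
    and \<pi>_zero: "\<lbrakk>i < n; r < m; s < m\<rbrakk> \<Longrightarrow> \<pi> \<zero> i r s = 0"
    and \<pi>_add: "\<lbrakk>x \<in> carrier S; y \<in> carrier S; i < n; r < m; s < m\<rbrakk> \<Longrightarrow>
      \<pi> (x \<oplus> y) i r s = \<pi> x i r s + \<pi> y i r s"
    and \<pi>_smult: "\<lbrakk>x \<in> carrier S; i < n; r < m; s < m\<rbrakk> \<Longrightarrow> \<pi> (c \<odot> x) i r s = c * \<pi> x i r s"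
    and \<pi>_mult: "\<lbrakk>x \<in> carrier S; y \<in> carrier S; i < n; r < m; s < m\<rbrakk> \<Longrightarrow>
      \<pi> (x \<otimes> y) i r s = (\<Sum>t<m. \<pi> x i r t * \<pi> y i t s)"
    and \<pi>_star: "\<lbrakk>x \<in> carrier S; i < n; r < m; s < m\<rbrakk> \<Longrightarrow> \<pi> (star S x) i r s = cnj (\<pi> x i s r)"
    and \<pi>_inj: "\<lbrakk>x \<in> carrier S; y \<in> carrier S;
      \<And>i r s. \<lbrakk>i < n; r < m; s < m\<rbrakk> \<Longrightarrow> \<pi> x i r s = \<pi> y i r s\<rbrakk> \<Longrightarrow> x = y"
    and \<pi>_surj: "\<exists>x\<in>carrier S. \<forall>i<n. \<forall>r<m. \<forall>s<m. \<pi> x i r s = F i r s"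
begin

lemmas closed = zero_closed add_closed smult_closed mult_closed star_closed
lemmas \<pi>_simps = \<pi>_zero \<pi>_add \<pi>_smult \<pi>_mult \<pi>_star

text \<open>Here and below, algebraic laws are checked on entries and pulled back by injectivity of
  \<open>\<pi>\<close>.\<close>

lemma abelian_group: "abelian_group S"
proof (rule abelian_groupI)
  fix x assume x: "x \<in> carrier S"
  show "\<exists>y\<in>carrier S. y \<oplus> x = \<zero>"
    by (rule bexI[of _ "(-1) \<odot> x"]) (auto intro!: \<pi>_inj simp: closed \<pi>_simps x)
qed (auto intro!: \<pi>_inj simp: closed \<pi>_simps)

text \<open>Subtraction is derived from the group structure and is not a field of the record, so its
  entries are computed from \<open>\<ominus> y \<oplus> y = \<zero>\<close>.\<close>

lemma \<pi>_minus:
  assumes "x \<in> carrier S" "y \<in> carrier S" "i < n" "r < m" "s < m"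
  shows "\<pi> (x \<ominus> y) i r s = \<pi> x i r s - \<pi> y i r s"
proof -
  interpret abelian_group S by (rule abelian_group)
  have "\<pi> (\<ominus> y) i r s + \<pi> y i r s = \<pi> (\<ominus> y \<oplus> y) i r s" using assms by (simp add: \<pi>_add)
  also have "\<dots> = 0" using assms by (simp add: l_neg \<pi>_zero)
  finally have "\<pi> (\<ominus> y) i r s = - \<pi> y i r s" by (simp add: eq_neg_iff_add_eq_0)
  then show ?thesis using assms by (simp add: a_minus_def \<pi>_add)
qed

lemma module: "Module.module (class_ring :: complex ring) S"
  by (rule Module.moduleI)
     (auto intro!: \<pi>_inj class_cring.is_cring abelian_group simp: closed \<pi>_simps algebra_simps)

lemma block_norm_star_mult:
  assumes "x \<in> carrier S"
  shows "block_norm n m (\<pi> (star S x \<otimes> x)) = (block_norm n m (\<pi> x))\<^sup>2"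
  using block_norm_cstar[of n m "\<pi> x"] assms
  by (simp add: madj_def closed \<pi>_simps cong: block_norm_cong)

text \<open>Entries are dominated by the norm, so they converge; \<open>\<pi>_surj\<close> realizes
  the limits by an element, and the sum of moduli turns entrywise convergence back into norm
  convergence.\<close>

lemma complete:
  assumes X: "\<And>k. X k \<in> carrier S"
    and cauchy: "\<forall>e>0. \<exists>k0. \<forall>k\<ge>k0. \<forall>l\<ge>k0. block_norm n m (\<pi> (X k \<ominus> X l)) < e"
  shows "\<exists>x\<in>carrier S. (\<lambda>k. block_norm n m (\<pi> (X k \<ominus> x))) \<longlonglongrightarrow> 0"
proof -
  interpret abelian_group S by (rule abelian_group)
  have "\<exists>l. (\<lambda>k. \<pi> (X k) i r s) \<longlonglongrightarrow> l" if "i < n" "r < m" "s < m" for i r s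
  proof -
    have "Cauchy (\<lambda>k. \<pi> (X k) i r s)"
    proof (rule CauchyI)
      fix e :: real assume "0 < e"
      then obtain k0 where "\<forall>k\<ge>k0. \<forall>l\<ge>k0. block_norm n m (\<pi> (X k \<ominus> X l)) < e"
        using cauchy by blast
      moreover have "cmod (\<pi> (X k) i r s - \<pi> (X l) i r s) \<le> block_norm n m (\<pi> (X k \<ominus> X l))" for k l
        using cmod_le_block_norm[OF that, of "\<pi> (X k \<ominus> X l)"] that X by (simp add: \<pi>_minus)
      ultimately show "\<exists>M. \<forall>k\<ge>M. \<forall>l\<ge>M. norm (\<pi> (X k) i r s - \<pi> (X l) i r s) < e"
        by (meson order_le_less_trans)
    qed
    then show ?thesis by (simp add: Cauchy_convergent_iff convergent_def)
  qed
  then obtain L where L: "\<And>i r s. \<lbrakk>i < n; r < m; s < m\<rbrakk> \<Longrightarrow> (\<lambda>k. \<pi> (X k) i r s) \<longlonglongrightarrow> L i r s"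
    by metis
  obtain x where x: "x \<in> carrier S" "\<And>i r s. \<lbrakk>i < n; r < m; s < m\<rbrakk> \<Longrightarrow> \<pi> x i r s = L i r s"
    using \<pi>_surj[of L] by blast
  have "(\<lambda>k. cmod (\<pi> (X k \<ominus> x) i r s)) \<longlonglongrightarrow> 0" if "i < n" "r < m" "s < m" for i r s
    using L[OF that] x that X by (simp add: \<pi>_minus tendsto_norm_zero LIM_zero)
  then have lim: "(\<lambda>k. \<Sum>i<n. \<Sum>r<m. \<Sum>s<m. cmod (\<pi> (X k \<ominus> x) i r s)) \<longlonglongrightarrow> 0"
    by (intro tendsto_null_sum) auto
  have "(\<lambda>k. block_norm n m (\<pi> (X k \<ominus> x))) \<longlonglongrightarrow> 0"
    by (rule tendsto_sandwich[OF _ _ tendsto_const lim])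
       (simp_all add: block_norm_nonneg block_norm_le block_bound_sum)
  then show ?thesis using x by blast
qed

lemma cstar_algebra:
  assumes norm: "\<And>x. x \<in> carrier S \<Longrightarrow> cnorm S x = block_norm n m (\<pi> x)"
  shows "cstar_algebra S"
proof (intro cstar_algebra.intro cstar_algebra_axioms.intro module)
  fix x y assume xy: "x \<in> carrier S" "y \<in> carrier S"
  show "cnorm S (x \<oplus> y) \<le> cnorm S x + cnorm S y"
    using block_norm_add[of n m "\<pi> x" "\<pi> y"] xy by (simp add: norm closed \<pi>_simps cong: block_norm_cong)
  show "cnorm S (x \<otimes> y) \<le> cnorm S x * cnorm S y"
    using block_norm_mult[of n m "\<pi> x" "\<pi> y"] xy by (simp add: norm closed \<pi>_simps cong: block_norm_cong)
next
  fix c x assume x: "x \<in> carrier S"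
  show "cnorm S (c \<odot> x) = cmod c * cnorm S x"
    using block_norm_scale[of n m c "\<pi> x"] x by (simp add: norm closed \<pi>_simps cong: block_norm_cong)
  show "cnorm S x = 0 \<longleftrightarrow> x = \<zero>"
    using x by (auto simp: norm block_norm_eq_0_iff \<pi>_zero intro!: \<pi>_inj zero_closed)
  show "cnorm S (star S x \<otimes> x) = (cnorm S x)\<^sup>2"
    using x by (simp add: norm closed block_norm_star_mult)
next
  interpret abelian_group S by (rule abelian_group)
  fix X assume X: "\<And>k::nat. X k \<in> carrier S"
    and "\<forall>e>0. \<exists>k0. \<forall>k\<ge>k0. \<forall>l\<ge>k0. cnorm S (X k \<ominus> X l) < e"
  then have "\<forall>e>0. \<exists>k0. \<forall>k\<ge>k0. \<forall>l\<ge>k0. block_norm n m (\<pi> (X k \<ominus> X l)) < e"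
    by (simp add: norm)
  from complete[OF X this] show "\<exists>x\<in>carrier S. (\<lambda>k. cnorm S (X k \<ominus> x)) \<longlonglongrightarrow> 0"
    using X by (auto simp: norm)
next
  fix x y z assume "x \<in> carrier S" "y \<in> carrier S" "z \<in> carrier S"
  then show "(x \<otimes> y) \<otimes> z = x \<otimes> (y \<otimes> z)"
    by (intro \<pi>_inj) (simp_all add: closed \<pi>_simps sum_distrib_left sum_distrib_right mult.assoc, rule sum.swap)
qed (auto intro!: \<pi>_inj simp: closed \<pi>_simps algebra_simps sum.distrib sum_distrib_left)

text \<open>The powers of \<open>star S x \<otimes> x\<close> with exponent \<open>2 ^ k\<close>.
  All are self-adjoint, so the C*-identity makes any C*-norm multiplicative along the
  squarings.\<close>

primrec square_seq :: "'b \<Rightarrow> nat \<Rightarrow> 'b" where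
  "square_seq x 0 = star S x \<otimes> x"
| "square_seq x (Suc k) = square_seq x k \<otimes> square_seq x k"

lemma square_seq_closed: "x \<in> carrier S \<Longrightarrow> square_seq x k \<in> carrier S"
  by (induction k) (simp_all add: closed)

lemma star_square_seq:
  assumes "x \<in> carrier S"
  shows "star S (square_seq x k) = square_seq x k"
proof (induction k)
  case 0
  show ?case using assms by (auto intro!: \<pi>_inj simp: closed \<pi>_simps mult.commute)
next
  case (Suc k)
  let ?y = "square_seq x k"
  have "star S (?y \<otimes> ?y) = star S ?y \<otimes> star S ?y"
    using square_seq_closed[OF assms, of k] by (auto intro!: \<pi>_inj simp: closed \<pi>_simps mult.commute)
  then show ?case by (simp add: Suc)
qed

lemma square_seq_norm:
  assumes N: "\<And>x. x \<in> carrier S \<Longrightarrow> N (star S x \<otimes> x) = (N x)\<^sup>2" and x: "x \<in> carrier S"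
  shows "N (square_seq x k) = (N x :: real) ^ 2 ^ Suc k"
proof (induction k)
  case 0
  show ?case using N[OF x] by simp
next
  case (Suc k)
  have "N (square_seq x (Suc k)) = (N (square_seq x k))\<^sup>2"
    using N[OF square_seq_closed[OF x, of k]] by (simp add: star_square_seq x)
  then show ?case by (simp only: Suc power_Suc flip: power_mult) (simp add: mult.commute)
qed

text \<open>Equivalent C*-norms are equal: for \<open>h = x* x\<close> both satisfy \<open>\<parallel>h\<^sup>q\<parallel> = \<parallel>h\<parallel>\<^sup>q\<close> with \<open>q = 2\<^sup>k\<close>, and
  the constant of equivalence disappears under \<open>q\<close>-th roots.\<close>

lemma cstar_norm_mono:
  assumes "\<And>x. x \<in> carrier S \<Longrightarrow> N (star S x \<otimes> x) = (N x)\<^sup>2"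
    and "\<And>x. x \<in> carrier S \<Longrightarrow> N' (star S x \<otimes> x) = (N' x)\<^sup>2"
    and "\<And>x. x \<in> carrier S \<Longrightarrow> 0 \<le> N x" "\<And>x. x \<in> carrier S \<Longrightarrow> 0 \<le> N' x"
    and le: "\<And>x. x \<in> carrier S \<Longrightarrow> N x \<le> C * (N' x :: real)" and x: "x \<in> carrier S"
  shows "N x \<le> N' x"
proof (rule le_of_power_le)
  fix k
  show "N x ^ 2 ^ Suc k \<le> C * N' x ^ 2 ^ Suc k"
    using le[OF square_seq_closed[OF x, of k]] square_seq_norm[of N x k] square_seq_norm[of N' x k] assms
    by simp
qed (use assms in auto)

text \<open>These are the matrix units of the blocks; an index out of range gives the zero
  element.\<close>

lemma exists_unit:
  "\<exists>E. \<forall>i r s. E i r s \<in> carrier S \<and> (\<forall>i'<n. \<forall>r'<m. \<forall>s'<m.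
     \<pi> (E i r s) i' r' s' = (if i' = i \<and> r' = r \<and> s' = s then 1 else 0))"
  using \<pi>_surj[of "\<lambda>i' r' s'. if i' = i \<and> r' = r \<and> s' = s then 1 else 0" for i r s] by metis

text \<open>Matrix units show that the given norm and \<open>block_norm\<close> dominate each other
  up to constants; \<open>cstar_norm_mono\<close> removes the constants in both directions.\<close>

lemma cstar_norm_unique:
  assumes "cstar_algebra S" and x: "x \<in> carrier S"
  shows "cnorm S x = block_norm n m (\<pi> x)"
proof -
  interpret cstar_algebra S by fact
  obtain E where E: "\<And>i r s. E i r s \<in> carrier S"
    and \<pi>_E: "\<And>i r s i' r' s'. \<lbrakk>i' < n; r' < m; s' < m\<rbrakk> \<Longrightarrow>
      \<pi> (E i r s) i' r' s' = (if i' = i \<and> r' = r \<and> s' = s then 1 else 0)"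
    using exists_unit by blast
  have cnorm_zero: "cnorm S \<zero> = 0" using norm_eq_0_iff[OF zero_closed] by simp
  \<comment> \<open>Nonnegativity is not among the axioms; it follows from the triangle inequality
    for \<open>y\<close> and \<open>-y\<close>.\<close>
  have cnorm_nonneg: "0 \<le> cnorm S y" if "y \<in> carrier S" for y
  proof -
    have "y \<oplus> (-1) \<odot> y = \<zero>" by (rule \<pi>_inj) (simp_all add: that closed \<pi>_simps)
    then show ?thesis
      using norm_triangle[of y "(-1) \<odot> y"] norm_smult[of y "-1"] that smult_closed cnorm_zero by simp
  qed
  have E_pos: "0 < cnorm S (E i r s)" if "i < n" "r < m" "s < m" for i r s
  proof -
    have "E i r s \<noteq> \<zero>" using \<pi>_E[OF that, of i r s] \<pi>_zero[OF that] by auto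
    then show ?thesis using norm_eq_0_iff[OF E[of i r s]] cnorm_nonneg[OF E[of i r s]] by linarith
  qed
  define J where "J = {..<n} \<times> {..<m} \<times> {..<m}"
  define e where "e = (\<lambda>(i, r, s). cnorm S (E i r s))"
  \<comment> \<open>Expansion of \<open>y\<close> in matrix units, done by induction on a set
    \<open>T\<close> containing the support: one entry is split off at a time, which avoids finite
    sums inside \<open>S\<close>.\<close>
  have supported: "cnorm S y \<le> (\<Sum>(i, r, s)\<in>T. cmod (\<pi> y i r s) * e (i, r, s))"
    if "finite T" "T \<subseteq> J" "y \<in> carrier S"
      "\<And>i r s. \<lbrakk>i < n; r < m; s < m; (i, r, s) \<notin> T\<rbrakk> \<Longrightarrow> \<pi> y i r s = 0" for T y
    using that
  proof (induction T arbitrary: y rule: finite_induct)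
    case empty
    then have "y = \<zero>" by (intro \<pi>_inj) (simp_all add: zero_closed \<pi>_zero)
    then show ?case by (simp add: cnorm_zero)
  next
    case (insert t T)
    obtain i r s where t: "t = (i, r, s)" by (cases t) auto
    then have irs: "i < n" "r < m" "s < m" using insert.prems by (auto simp: J_def)
    obtain z where z: "z \<in> carrier S" "\<And>i' r' s'. \<lbrakk>i' < n; r' < m; s' < m\<rbrakk> \<Longrightarrow>
        \<pi> z i' r' s' = (if (i', r', s') = t then 0 else \<pi> y i' r' s')"
      using \<pi>_surj[of "\<lambda>i' r' s'. if (i', r', s') = t then 0 else \<pi> y i' r' s'"] by blast
    have y: "y = z \<oplus> \<pi> y i r s \<odot> E i r s"
      using insert.prems z E by (intro \<pi>_inj) (auto simp: closed \<pi>_simps \<pi>_E t)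
    have "cnorm S z \<le> (\<Sum>(i, r, s)\<in>T. cmod (\<pi> z i r s) * e (i, r, s))"
      using insert.prems z by (intro insert.IH) auto
    also have "\<dots> = (\<Sum>(i, r, s)\<in>T. cmod (\<pi> y i r s) * e (i, r, s))"
      using insert.hyps insert.prems z(2) by (intro sum.cong) (auto simp: J_def)
    finally have "cnorm S z \<le> \<dots>" .
    moreover have "cnorm S y \<le> cnorm S z + cmod (\<pi> y i r s) * cnorm S (E i r s)"
      using norm_triangle[of z "\<pi> y i r s \<odot> E i r s"] z E y by (simp add: norm_smult closed)
    ultimately show ?case using insert.hyps by (simp add: t e_def)
  qed
  have upper: "cnorm S y \<le> (\<Sum>t\<in>J. e t) * block_norm n m (\<pi> y)" if y: "y \<in> carrier S" for y
  proof -
    have "cnorm S y \<le> (\<Sum>(i, r, s)\<in>J. cmod (\<pi> y i r s) * e (i, r, s))"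
      using y by (intro supported) (auto simp: J_def)
    also have "\<dots> \<le> (\<Sum>(i, r, s)\<in>J. block_norm n m (\<pi> y) * e (i, r, s))"
      using cnorm_nonneg E
      by (intro sum_mono) (auto simp: J_def e_def intro!: mult_right_mono cmod_le_block_norm)
    finally show ?thesis by (simp add: sum_distrib_right mult.commute case_prod_unfold)
  qed
  define C where "C = (\<lambda>i r s. cnorm S (E i r r) * cnorm S (E i s s) / cnorm S (E i r s))"
  have entry: "cmod (\<pi> y i r s) \<le> C i r s * cnorm S y"
    if y: "y \<in> carrier S" and irs: "i < n" "r < m" "s < m" for y i r s
  proof -
    \<comment> \<open>Multiplying by diagonal units from both sides isolates a single entry, which
      submultiplicativity then bounds.\<close>
    have "\<pi> y i r s \<odot> E i r s = E i r r \<otimes> (y \<otimes> E i s s)"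
      using y E irs
      by (intro \<pi>_inj) (auto simp: closed \<pi>_simps \<pi>_E if_distrib if_distribR cong: if_cong)
    then have "cmod (\<pi> y i r s) * cnorm S (E i r s) = cnorm S (E i r r \<otimes> (y \<otimes> E i s s))"
      using E norm_smult by metis
    also have "\<dots> \<le> cnorm S (E i r r) * (cnorm S y * cnorm S (E i s s))"
      using y E cnorm_nonneg
      by (meson closed(4) norm_mult mult_left_mono order_trans)
    finally show ?thesis using E_pos[OF irs] by (simp add: C_def field_simps)
  qed
  have lower: "block_norm n m (\<pi> y) \<le> (\<Sum>i<n. \<Sum>r<m. \<Sum>s<m. C i r s) * cnorm S y"
    if y: "y \<in> carrier S" for y
  proof -
    have "block_norm n m (\<pi> y) \<le> (\<Sum>i<n. \<Sum>r<m. \<Sum>s<m. cmod (\<pi> y i r s))"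
      by (intro block_norm_le block_bound_sum)
    also have "\<dots> \<le> (\<Sum>i<n. \<Sum>r<m. \<Sum>s<m. C i r s * cnorm S y)"
      using y by (intro sum_mono entry) auto
    finally show ?thesis by (simp add: sum_distrib_right)
  qed
  show ?thesis
    using cstar_norm_mono[of "cnorm S" "\<lambda>y. block_norm n m (\<pi> y)" _ x, OF _ _ _ _ upper x]
      cstar_norm_mono[of "\<lambda>y. block_norm n m (\<pi> y)" "cnorm S" _ x, OF _ _ _ _ lower x]
    by (intro antisym) (simp_all add: cstar_identity block_norm_star_mult cnorm_nonneg block_norm_nonneg)
qed

end


section \<open>Tensor products of operators\<close>

lemma cinner_Times: "cinner (I \<times> J) v w = (\<Sum>k\<in>I. cinner J (\<lambda>j. v (k, j)) (\<lambda>j. w (k, j)))"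
  by (simp add: cinner_def sum.cartesian_product case_prod_unfold)

lemma cinner_Times': "cinner (I \<times> J) v w = (\<Sum>j\<in>J. cinner I (\<lambda>k. v (k, j)) (\<lambda>k. w (k, j)))"
  unfolding cinner_Times unfolding cinner_def by (rule sum.swap)

lemma vnorm_Times_sq: "(vnorm (I \<times> J) v)\<^sup>2 = (\<Sum>k\<in>I. (vnorm J (\<lambda>j. v (k, j)))\<^sup>2)"
  by (simp add: vnorm_sq cinner_Times)

lemma vnorm_Times_sq': "(vnorm (I \<times> J) v)\<^sup>2 = (\<Sum>j\<in>J. (vnorm I (\<lambda>k. v (k, j)))\<^sup>2)"
  by (simp add: vnorm_sq cinner_Times')

text \<open>\<open>mv_fst\<close> is \<open>M\<close> tensored with the identity,
  \<open>mv_snd\<close> the identity tensored with \<open>M\<close>, both acting on functions of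
  index pairs.\<close>

definition mv_fst :: "'k set \<Rightarrow> ('k \<Rightarrow> 'k \<Rightarrow> complex) \<Rightarrow> ('k \<times> 'i \<Rightarrow> complex) \<Rightarrow> 'k \<times> 'i \<Rightarrow> complex" where
  "mv_fst K M z = (\<lambda>(k, i). mv K M (\<lambda>l. z (l, i)) k)"

definition mv_snd :: "'i set \<Rightarrow> ('i \<Rightarrow> 'i \<Rightarrow> complex) \<Rightarrow> ('k \<times> 'i \<Rightarrow> complex) \<Rightarrow> 'k \<times> 'i \<Rightarrow> complex" where
  "mv_snd I M z = (\<lambda>(k, i). mv I M (\<lambda>j. z (k, j)) i)"

lemma mv_fst_snd_commute: "mv_fst K M (mv_snd I N z) = mv_snd I N (mv_fst K M z)"
  unfolding mv_fst_def mv_snd_def mv_def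
  by (simp add: fun_eq_iff sum_distrib_left) (subst sum.swap, simp add: algebra_simps)

text \<open>The squared norm is the sum of the squared norms of the slices, and the operator acts on
  each slice separately.\<close>

lemma vnorm_mv_fst_le:
  assumes "\<And>v. vnorm K (mv K M v) \<le> vnorm K v"
  shows "vnorm (K \<times> I) (mv_fst K M z) \<le> vnorm (K \<times> I) z"
  by (rule power2_le_imp_le)
     (auto simp: vnorm_Times_sq' mv_fst_def intro!: sum_mono power_mono assms)

lemma vnorm_mv_snd_le:
  assumes "\<And>v. vnorm I (mv I M v) \<le> vnorm I v"
  shows "vnorm (K \<times> I) (mv_snd I M z) \<le> vnorm (K \<times> I) z"
  by (rule power2_le_imp_le)
     (auto simp: vnorm_Times_sq mv_snd_def intro!: sum_mono power_mono assms)

text \<open>The \<open>a\<close>-operators sit on the second factor and the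
  \<open>b\<close>-operators on the first, in agreement with the flattening in
  \<open>cb_norm_to_mat\<close>, where the blocks are indexed by the matrix over
  \<open>B\<close>.\<close>

lemma commuting_contractions_tensor:
  fixes M :: "nat \<Rightarrow> 'i \<Rightarrow> 'i \<Rightarrow> complex" and N :: "nat \<Rightarrow> 'k \<Rightarrow> 'k \<Rightarrow> complex"
  assumes "\<And>k v. k < 4 \<Longrightarrow> vnorm I (mv I (M k) v) \<le> vnorm I v"
    and "\<And>j v. j < 2 \<Longrightarrow> vnorm K (mv K (N j) v) \<le> vnorm K v"
  shows "commuting_contractions (K \<times> I) (\<lambda>k. mv_snd I (M k)) (\<lambda>k. mv_snd I (madj (M k)))
    (\<lambda>j. mv_fst K (N j)) (\<lambda>j. mv_fst K (madj (N j)))"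
proof
  fix k j :: nat and c :: complex and v w :: "'k \<times> 'i \<Rightarrow> complex"
  show "cinner (K \<times> I) (mv_snd I (M k) v) w = cinner (K \<times> I) v (mv_snd I (madj (M k)) w)"
    by (simp add: cinner_Times mv_snd_def cinner_mv_left)
  show "cinner (K \<times> I) (mv_fst K (N j) v) w = cinner (K \<times> I) v (mv_fst K (madj (N j)) w)"
    by (simp add: cinner_Times' mv_fst_def cinner_mv_left)
  show "mv_snd I (madj (M k)) (\<lambda>i. v i + c * w i)
      = (\<lambda>i. mv_snd I (madj (M k)) v i + c * mv_snd I (madj (M k)) w i)"
    by (simp add: mv_snd_def mv_add_scale fun_eq_iff)
  show "mv_fst K (madj (N j)) (\<lambda>i. v i + c * w i)
      = (\<lambda>i. mv_fst K (madj (N j)) v i + c * mv_fst K (madj (N j)) w i)"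
    by (simp add: mv_fst_def mv_add_scale fun_eq_iff)
qed (simp_all add: assms vnorm_mv_snd_le vnorm_mv_fst_le mv_fst_snd_commute)

section \<open>Flattening of index pairs, and norms of complex matrices\<close>

lemma mult_add_less:
  fixes k i m n :: nat
  assumes "k < m" "i < n"
  shows "k * n + i < m * n"
proof -
  have "k * n + i < Suc k * n" using assms by simp
  also have "\<dots> \<le> m * n" using assms by (intro mult_le_mono1) simp
  finally show ?thesis .
qed

lemma bij_betw_div_mod:
  fixes m n :: nat
  shows "bij_betw (\<lambda>(k, i). k * n + i) ({..<m} \<times> {..<n}) {..<m * n}"
proof (rule bij_betw_byWitness[where f' = "\<lambda>p. (p div n, p mod n)"])
  show "(\<lambda>(k, i). k * n + i) ` ({..<m} \<times> {..<n}) \<subseteq> {..<m * n}"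
    by (auto intro: mult_add_less)
  have "p div n < m \<and> p mod n < n" if "p < m * n" for p
  proof -
    have "0 < n" using that by (cases n) auto
    then show ?thesis using that by (simp add: less_mult_imp_div_less)
  qed
  then show "(\<lambda>p. (p div n, p mod n)) ` {..<m * n} \<subseteq> {..<m} \<times> {..<n}" by auto
qed auto

lemma sum_div_mod:
  fixes m n :: nat
  shows "(\<Sum>p<m * n. f p) = (\<Sum>k<m. \<Sum>i<n. f (k * n + i))"
  using sum.reindex_bij_betw[OF bij_betw_div_mod, of f n m]
  by (simp add: sum.cartesian_product case_prod_unfold)

lemma vnorm_div_mod:
  fixes m n :: nat
  shows "vnorm {..<m * n} f = vnorm ({..<m} \<times> {..<n}) (\<lambda>(k, i). f (k * n + i))"
  using sum_div_mod[of "\<lambda>i. (cmod (f i))\<^sup>2" m n]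
  by (simp only: vnorm_def L2_set_def sum.cartesian_product case_prod_unfold)

lemma cmat_norm_leI:
  assumes "\<And>v. \<lbrakk>v \<in> carrier_vec (dim_col M); l2_norm v \<le> 1\<rbrakk> \<Longrightarrow> l2_norm (M *\<^sub>v v) \<le> c"
  shows "cmat_norm M \<le> ennreal c"
  unfolding cmat_norm_def by (rule SUP_least) (auto intro!: ennreal_leI assms)

lemma cmod_entry_le_cmat_norm:
  assumes "r < dim_row M" "s < dim_col M"
  shows "ennreal (cmod (M $$ (r, s))) \<le> cmat_norm M"
proof -
  let ?e = "unit_vec (dim_col M) s :: complex vec"
  have "(M *\<^sub>v ?e) $ r = M $$ (r, s)" using assms by simp
  then have "cmod (M $$ (r, s)) \<le> l2_norm (M *\<^sub>v ?e)"
    using member_le_L2_set[of "{..<dim_row M}" r "\<lambda>i. cmod ((M *\<^sub>v ?e) $ i)"] assms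
    by (simp add: l2_norm_def)
  moreover have "l2_norm ?e = 1"
    using assms by (simp add: l2_norm_def L2_set_def unit_vec_def if_distrib if_distribR cong: if_cong)
  ultimately show ?thesis
    unfolding cmat_norm_def by (intro SUP_upper2[of ?e]) (auto intro: ennreal_leI)
qed


section \<open>The form on function algebras\<close>

text \<open>Real numbers are coded as sets of naturals. A complex sequence becomes a set of triples
  of an index, a flag for real or imaginary part, and a member of the coded part; triples are
  countable, so this is again a set of naturals.\<close>

lemma exists_embedding:
  assumes "(UNIV :: real set) \<lesssim> (UNIV :: 'a set)"
  shows "\<exists>\<iota> :: (nat \<Rightarrow> complex) \<Rightarrow> 'a. inj \<iota>"
proof -
  obtain g :: "real \<Rightarrow> nat set" where g: "inj g"
    using eqpoll_imp_lepoll[OF eqpoll_sym[OF nat_sets_eqpoll_reals]] by (auto simp: lepoll_def)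
  obtain h :: "nat set \<Rightarrow> 'a" where h: "inj h"
    using lepoll_trans1[OF nat_sets_eqpoll_reals assms] by (auto simp: lepoll_def)
  define G :: "(nat \<Rightarrow> complex) \<Rightarrow> nat set" where
    "G f = to_nat ` {(i, c, k). k \<in> g (if c then Re (f i) else Im (f i))}" for f
  have "inj G"
  proof (rule injI)
    fix f f' :: "nat \<Rightarrow> complex" assume "G f = G f'"
    then have eq: "{(i, c, k). k \<in> g (if c then Re (f i) else Im (f i))}
        = {(i, c, k). k \<in> g (if c then Re (f' i) else Im (f' i))}"
      unfolding G_def by (simp add: inj_image_eq_iff)
    have "g (if c then Re (f i) else Im (f i)) = g (if c then Re (f' i) else Im (f' i))" for i c
      using eq by (auto simp: set_eq_iff)
    then have "(if c then Re (f i) else Im (f i)) = (if c then Re (f' i) else Im (f' i))" for i c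
      using g by (simp add: inj_eq)
    from this[of True] this[of False] show "f = f'" by (simp add: fun_eq_iff complex_eq_iff)
  qed
  then have "inj (h \<circ> G)" using h by (simp add: inj_compose)
  then show ?thesis by blast
qed

text \<open>The algebra of functions on \<open>n\<close> points; an injection \<open>\<iota>\<close> carries it over to the type \<open>'a\<close>.\<close>

definition diag_cstar :: "((nat \<Rightarrow> complex) \<Rightarrow> 'a) \<Rightarrow> nat \<Rightarrow> 'a cstar_struct" where
  "diag_cstar \<iota> n = \<lparr>
     carrier = \<iota> ` {f. \<forall>i\<ge>n. f i = 0},
     monoid.mult = (\<lambda>x y. \<iota> (\<lambda>i. inv_into UNIV \<iota> x i * inv_into UNIV \<iota> y i)),
     one = \<iota> (\<lambda>i. if i < n then 1 else 0),
     ring.zero = \<iota> (\<lambda>i. 0),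
     ring.add = (\<lambda>x y. \<iota> (\<lambda>i. inv_into UNIV \<iota> x i + inv_into UNIV \<iota> y i)),
     module.smult = (\<lambda>c x. \<iota> (\<lambda>i. c * inv_into UNIV \<iota> x i)),
     star = (\<lambda>x. \<iota> (\<lambda>i. cnj (inv_into UNIV \<iota> x i))),
     cnorm = (\<lambda>x. block_norm n 1 (\<lambda>i r s. inv_into UNIV \<iota> x i))\<rparr>"

locale embedding =
  fixes \<iota> :: "(nat \<Rightarrow> complex) \<Rightarrow> 'a"
  assumes inj: "inj \<iota>"
begin

abbreviation \<kappa> :: "'a \<Rightarrow> nat \<Rightarrow> complex" where "\<kappa> \<equiv> inv_into UNIV \<iota>"

lemma \<kappa>_\<iota> [simp]: "\<kappa> (\<iota> f) = f"
  using inj by simp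

lemma \<iota>_eq_iff [simp]: "\<iota> f = \<iota> g \<longleftrightarrow> f = g"
  using inj by (simp add: inj_eq)

lemma diag_carrier: "carrier (diag_cstar \<iota> n) = \<iota> ` {f. \<forall>i\<ge>n. f i = 0}"
  by (simp add: diag_cstar_def)

lemma \<iota>_in_carrier [simp]: "\<iota> f \<in> carrier (diag_cstar \<iota> n) \<longleftrightarrow> (\<forall>i\<ge>n. f i = 0)"
  by (auto simp: diag_carrier)

lemma diag_eqI:
  assumes "x \<in> carrier (diag_cstar \<iota> n)" "y \<in> carrier (diag_cstar \<iota> n)"
    and "\<And>i. i < n \<Longrightarrow> \<kappa> x i = \<kappa> y i"
  shows "x = y"
  using assms by (auto simp: diag_carrier fun_eq_iff) (metis not_le)

text \<open>Functions on \<open>n\<close> points are diagonal operators with blocks of size 1, so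
  the block norm is the supremum norm.\<close>

lemma block_rep_diag: "block_rep n 1 (diag_cstar \<iota> n) (\<lambda>x i r s. \<kappa> x i)"
proof (unfold_locales, goal_cases)
  case (11 x y)
  then show ?case by (intro diag_eqI) auto
next
  case (12 F)
  show ?case by (rule bexI[of _ "\<iota> (\<lambda>i. if i < n then F i 0 0 else 0)"]) auto
qed (auto simp: diag_cstar_def)

lemma cstar_algebra_diag: "cstar_algebra (diag_cstar \<iota> n)"
  by (rule block_rep.cstar_algebra[OF block_rep_diag]) (simp add: diag_cstar_def)

lemma \<kappa>_simps:
  "\<kappa> \<zero>\<^bsub>diag_cstar \<iota> n\<^esub> i = 0"
  "\<kappa> (x \<oplus>\<^bsub>diag_cstar \<iota> n\<^esub> y) i = \<kappa> x i + \<kappa> y i"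
  "\<kappa> (c \<odot>\<^bsub>diag_cstar \<iota> n\<^esub> x) i = c * \<kappa> x i"
  "\<kappa> (x \<otimes>\<^bsub>diag_cstar \<iota> n\<^esub> y) i = \<kappa> x i * \<kappa> y i"
  "\<kappa> (star (diag_cstar \<iota> n) x) i = cnj (\<kappa> x i)"
  by (simp_all add: diag_cstar_def)

text \<open>Needed for the products in \<open>matrix_cstar\<close>. Membership and coordinates are
  proved together because \<open>finsum_insert\<close> requires closed summands.\<close>

lemma finsum_diag:
  assumes "finite T" "\<And>k. k \<in> T \<Longrightarrow> f k \<in> carrier (diag_cstar \<iota> n)"
  shows "finsum (diag_cstar \<iota> n) f T \<in> carrier (diag_cstar \<iota> n) \<and>
    (\<forall>i. \<kappa> (finsum (diag_cstar \<iota> n) f T) i = (\<Sum>k\<in>T. \<kappa> (f k) i))"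
proof -
  interpret abelian_group "diag_cstar \<iota> n" by (rule block_rep.abelian_group[OF block_rep_diag])
  show ?thesis using assms
  proof (induction T rule: finite_induct)
    case empty
    then show ?case by (simp add: \<kappa>_simps)
  next
    case (insert k T)
    then have "finsum (diag_cstar \<iota> n) f (insert k T) = f k \<oplus>\<^bsub>diag_cstar \<iota> n\<^esub> finsum (diag_cstar \<iota> n) f T"
      by (intro finsum_insert) auto
    then show ?case using insert a_closed[of "f k" "finsum (diag_cstar \<iota> n) f T"]
      by (simp add: \<kappa>_simps)
  qed
qed

lemma matrix_product_diag:
  assumes "\<forall>r<m. \<forall>s<m. X $$ (r, s) \<in> carrier (diag_cstar \<iota> n)"
    and "\<forall>r<m. \<forall>s<m. Y $$ (r, s) \<in> carrier (diag_cstar \<iota> n)" and rs: "r < m" "s < m"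
  shows "(\<Oplus>\<^bsub>diag_cstar \<iota> n\<^esub>k\<in>{..<m}. X $$ (r, k) \<otimes>\<^bsub>diag_cstar \<iota> n\<^esub> Y $$ (k, s)) \<in> carrier (diag_cstar \<iota> n)"
    and "\<kappa> (\<Oplus>\<^bsub>diag_cstar \<iota> n\<^esub>k\<in>{..<m}. X $$ (r, k) \<otimes>\<^bsub>diag_cstar \<iota> n\<^esub> Y $$ (k, s)) i
      = (\<Sum>k<m. \<kappa> (X $$ (r, k)) i * \<kappa> (Y $$ (k, s)) i)"
proof -
  have "X $$ (r, k) \<otimes>\<^bsub>diag_cstar \<iota> n\<^esub> Y $$ (k, s) \<in> carrier (diag_cstar \<iota> n)" if "k \<in> {..<m}" for k
    using assms that by (intro block_rep.mult_closed[OF block_rep_diag]) auto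
  note fin = finsum_diag[of "{..<m}" "\<lambda>k. X $$ (r, k) \<otimes>\<^bsub>diag_cstar \<iota> n\<^esub> Y $$ (k, s)" n,
    OF finite_lessThan this]
  show "(\<Oplus>\<^bsub>diag_cstar \<iota> n\<^esub>k\<in>{..<m}. X $$ (r, k) \<otimes>\<^bsub>diag_cstar \<iota> n\<^esub> Y $$ (k, s)) \<in> carrier (diag_cstar \<iota> n)"
    using fin by blast
  show "\<kappa> (\<Oplus>\<^bsub>diag_cstar \<iota> n\<^esub>k\<in>{..<m}. X $$ (r, k) \<otimes>\<^bsub>diag_cstar \<iota> n\<^esub> Y $$ (k, s)) i
      = (\<Sum>k<m. \<kappa> (X $$ (r, k)) i * \<kappa> (Y $$ (k, s)) i)"
    using fin[THEN conjunct2, rule_format, of i] by (simp only: \<kappa>_simps)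
qed

text \<open>Matrices over functions on \<open>n\<close> points are \<open>n\<close> complex
  matrices: block \<open>i\<close> evaluates all entries at point \<open>i\<close>.\<close>

lemma block_rep_matrix:
  "block_rep n m (matrix_cstar m (diag_cstar \<iota> n) N) (\<lambda>X i r s. \<kappa> (X $$ (r, s)) i)"
proof -
  interpret D: block_rep n 1 "diag_cstar \<iota> n" "\<lambda>x i r s. \<kappa> x i" by (rule block_rep_diag)
  show ?thesis
  proof (unfold_locales, goal_cases)
    case (11 X Y)
    then have "X $$ (r, s) = Y $$ (r, s)" if "r < m" "s < m" for r s
      using that by (intro diag_eqI[of _ n]) (auto simp: matrix_cstar_def)
    then show ?case using 11 by (intro eq_matI) (auto simp: matrix_cstar_def)
  next
    case (12 F)
    show ?case
      by (rule bexI[of _ "mat m m (\<lambda>(r, s). \<iota> (\<lambda>i. if i < n then F i r s else 0))"])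
         (auto simp: matrix_cstar_def)
  qed (auto simp: matrix_cstar_def D.closed matrix_product_diag \<kappa>_simps)
qed

text \<open>The block norm is a C*-norm on the matrices, and by \<open>cstar_norm_unique\<close>
  every other one has the same value at \<open>X\<close>; this resolves the definite
  description.\<close>

lemma matrix_norm_diag:
  assumes "X \<in> carrier_mat m m" "\<forall>r<m. \<forall>s<m. X $$ (r, s) \<in> carrier (diag_cstar \<iota> n)"
  shows "matrix_norm m (diag_cstar \<iota> n) X = block_norm n m (\<lambda>i r s. \<kappa> (X $$ (r, s)) i)"
  unfolding matrix_norm_def
proof (rule the_equality)
  let ?N = "\<lambda>X. block_norm n m (\<lambda>i r s. \<kappa> (X $$ (r, s)) i)"
  have "cstar_algebra (matrix_cstar m (diag_cstar \<iota> n) ?N)"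
    by (rule block_rep.cstar_algebra[OF block_rep_matrix]) (simp add: matrix_cstar_def)
  then show "\<exists>N. cstar_algebra (matrix_cstar m (diag_cstar \<iota> n) N) \<and> N X = ?N X" by blast
next
  fix c assume "\<exists>N. cstar_algebra (matrix_cstar m (diag_cstar \<iota> n) N) \<and> N X = c"
  then obtain N where "cstar_algebra (matrix_cstar m (diag_cstar \<iota> n) N)" and c: "N X = c" by blast
  then show "c = block_norm n m (\<lambda>i r s. \<kappa> (X $$ (r, s)) i)"
    using block_rep.cstar_norm_unique[OF block_rep_matrix, of m n N X] assms
    by (simp add: matrix_cstar_def)
qed

lemma matrix_ball_diag:
  "X \<in> matrix_ball m (diag_cstar \<iota> n) \<longleftrightarrow> X \<in> carrier_mat m m \<and>
     (\<forall>r<m. \<forall>s<m. X $$ (r, s) \<in> carrier (diag_cstar \<iota> n)) \<and>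
     block_bound n m (\<lambda>i r s. \<kappa> (X $$ (r, s)) i) 1"
  unfolding matrix_ball_def using matrix_norm_diag[of X m n] block_norm_le_iff[of 1 n m] by auto

section \<open>The form and the bound on its joint norm\<close>

abbreviation A where "A \<equiv> diag_cstar \<iota> 4"
abbreviation B where "B \<equiv> diag_cstar \<iota> 2"

definition gap_form :: "'a \<Rightarrow> 'a \<Rightarrow> complex" where
  "gap_form x y = (\<Sum>k<4. \<kappa> x k * (\<kappa> y 0 + \<i> ^ k * \<kappa> y 1))"

lemma cmod_\<kappa>_le: "i < n \<Longrightarrow> cmod (\<kappa> x i) \<le> cnorm (diag_cstar \<iota> n) x"
  using cmod_le_block_norm[of i n 0 1 0 "\<lambda>i r s. \<kappa> x i"] by (simp add: diag_cstar_def)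

lemma bounded_gap_form: "bounded_bilinear_form A B gap_form"
  unfolding bounded_bilinear_form_def
proof
  show "bilinear_form A B gap_form"
    unfolding bilinear_form_def gap_form_def \<kappa>_simps
    by (simp add: sum_distrib_left algebra_simps sum.distrib)
  have "cmod (gap_form x y) \<le> 8 * cnorm A x * cnorm B y" for x y
  proof -
    have "cmod (gap_form x y) \<le> (\<Sum>k<4::nat. cnorm A x * (2 * cnorm B y))"
      unfolding gap_form_def
    proof (rule sum_norm_le)
      fix k :: nat assume k: "k \<in> {..<4}"
      have "cmod (\<kappa> y 0 + \<i> ^ k * \<kappa> y 1) \<le> cmod (\<kappa> y 0) + cmod (\<i> ^ k * \<kappa> y 1)"
        by (rule norm_triangle_ineq)
      also have "\<dots> \<le> 2 * cnorm B y"
        using cmod_\<kappa>_le[of 0 2 y] cmod_\<kappa>_le[of 1 2 y] by (simp add: norm_mult cmod_i_power)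
      finally show "cmod (\<kappa> x k * (\<kappa> y 0 + \<i> ^ k * \<kappa> y 1)) \<le> cnorm A x * (2 * cnorm B y)"
        using cmod_\<kappa>_le[of k 4 x] k order_trans[OF norm_ge_zero cmod_\<kappa>_le[of 0 4 x]]
        unfolding norm_mult by (intro mult_mono) simp_all
    qed
    then show ?thesis by simp
  qed
  then show "\<exists>C. \<forall>a\<in>carrier A. \<forall>b\<in>carrier B. cmod (gap_form a b) \<le> C * cnorm A a * cnorm B b"
    by blast
qed

text \<open>With \<open>M c\<close> and \<open>N j\<close> the values of \<open>X\<close> and
  \<open>Y\<close> at the points \<open>c\<close> and \<open>j\<close>, the flattened matrix is the
  sum over \<open>c < 4\<close> of \<open>N 0 + \<i> ^ c * N 1\<close> tensored with
  \<open>M c\<close>, so \<open>gap_norm\<close> applies.\<close>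

lemma cmat_norm_gap_form:
  assumes "1 \<le> n" "X \<in> matrix_ball n A" "Y \<in> matrix_ball m B"
  shows "cmat_norm (mat (m * n) (m * n) (\<lambda>(p, q). map_mat (\<lambda>f. f (Y $$ (p div n, q div n)))
      (map_mat gap_form X) $$ (p mod n, q mod n))) \<le> ennreal gap_const"
    (is "cmat_norm ?T \<le> _")
proof (rule cmat_norm_leI)
  fix v assume "v \<in> carrier_vec (dim_col ?T)" and v_le: "l2_norm v \<le> 1"
  then have v: "v \<in> carrier_vec (m * n)" by simp
  have n: "0 < n" using assms(1) by simp
  have X: "X \<in> carrier_mat n n" "block_bound 4 n (\<lambda>i r s. \<kappa> (X $$ (r, s)) i) 1"
    using assms(2) unfolding matrix_ball_diag by blast+
  have Y: "block_bound 2 m (\<lambda>i r s. \<kappa> (Y $$ (r, s)) i) 1"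
    using assms(3) unfolding matrix_ball_diag by blast
  define M where "M = (\<lambda>k i j. \<kappa> (X $$ (i, j)) k)"
  define N where "N = (\<lambda>k i j. \<kappa> (Y $$ (i, j)) k)"
  define z where "z = (\<lambda>(l, j). v $ (l * n + j))"
  define T where "T = ?T"
  let ?I = "{..<m} \<times> {..<n}"
  have M_contraction: "vnorm {..<n} (mv {..<n} (M k) w) \<le> vnorm {..<n} w" if "k < 4" for k w
  proof -
    have "vnorm {..<n} (mv {..<n} (M k) w) \<le> 1 * vnorm {..<n} w"
      using X(2) that unfolding block_bound_def M_def by blast
    then show ?thesis by simp
  qed
  have N_contraction: "vnorm {..<m} (mv {..<m} (N k) w) \<le> vnorm {..<m} w" if "k < 2" for k w
  proof -
    have "vnorm {..<m} (mv {..<m} (N k) w) \<le> 1 * vnorm {..<m} w"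
      using Y that unfolding block_bound_def N_def by blast
    then show ?thesis by simp
  qed
  interpret commuting_contractions ?I "\<lambda>k. mv_snd {..<n} (M k)" "\<lambda>k. mv_snd {..<n} (madj (M k))"
    "\<lambda>j. mv_fst {..<m} (N j)" "\<lambda>j. mv_fst {..<m} (madj (N j))"
    by (rule commuting_contractions_tensor; rule M_contraction N_contraction; assumption)
  have entry: "(T *\<^sub>v v) $ (k * n + i) = (\<Sum>c<4. mv_snd {..<n} (M c)
      (\<lambda>i. mv_fst {..<m} (N 0) z i + \<i> ^ c * mv_fst {..<m} (N 1) z i) (k, i))"
    if ki: "k < m" "i < n" for k i
  proof -
    have "(T *\<^sub>v v) $ (k * n + i) = (\<Sum>q<m * n. T $$ (k * n + i, q) * v $ q)"
      using mult_add_less[OF ki] v by (simp add: T_def scalar_prod_def lessThan_atLeast0)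
    also have "\<dots> = (\<Sum>l<m. \<Sum>j<n. gap_form (X $$ (i, j)) (Y $$ (k, l)) * z (l, j))"
      unfolding sum_div_mod using ki X by (intro sum.cong refl) (simp add: T_def mult_add_less z_def)
    also have "\<dots> = (\<Sum>l<m. \<Sum>j<n. \<Sum>c<4. M c i j * (N 0 k l + \<i> ^ c * N 1 k l) * z (l, j))"
      by (simp add: gap_form_def M_def N_def sum_distrib_right)
    also have "\<dots> = (\<Sum>c<4. \<Sum>j<n. \<Sum>l<m. M c i j * (N 0 k l + \<i> ^ c * N 1 k l) * z (l, j))"
      by (subst (2) sum.swap, subst (1) sum.swap, subst (3) sum.swap) (rule refl)
    also have "\<dots> = (\<Sum>c<4. mv_snd {..<n} (M c)
      (\<lambda>i. mv_fst {..<m} (N 0) z i + \<i> ^ c * mv_fst {..<m} (N 1) z i) (k, i))"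
      unfolding mv_snd_def mv_fst_def mv_def prod.case
      by (intro sum.cong refl) (simp add: sum_distrib_left sum.distrib algebra_simps)
    finally show ?thesis .
  qed
  have "vnorm ?I z \<le> 1"
    using v v_le vnorm_div_mod[of m n "\<lambda>i. v $ i"] by (simp add: l2_norm_def vnorm_def z_def)
  then have "vnorm ?I (\<lambda>i. \<Sum>c<4. mv_snd {..<n} (M c)
      (\<lambda>i. mv_fst {..<m} (N 0) z i + \<i> ^ c * mv_fst {..<m} (N 1) z i) i) \<le> gap_const"
    by (rule gap_norm)
  also have "vnorm ?I (\<lambda>i. \<Sum>c<4. mv_snd {..<n} (M c)
      (\<lambda>i. mv_fst {..<m} (N 0) z i + \<i> ^ c * mv_fst {..<m} (N 1) z i) i)
      = vnorm ?I (\<lambda>(k, i). (T *\<^sub>v v) $ (k * n + i))"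
    by (rule vnorm_cong) (auto simp: entry)
  also have "\<dots> = l2_norm (T *\<^sub>v v)"
    using vnorm_div_mod[of m n "\<lambda>i. (T *\<^sub>v v) $ i"] by (simp add: l2_norm_def vnorm_def T_def)
  finally show "l2_norm (?T *\<^sub>v v) \<le> gap_const" by (simp only: T_def)
qed

lemma jcb_norm_gap_form: "jcb_norm A B gap_form \<le> ennreal gap_const"
  unfolding jcb_norm_def dual_matrix_norm_def cb_norm_to_mat_def
  by (intro SUP_least cmat_norm_gap_form) simp_all

section \<open>The lower bound for every decomposition\<close>

lemma sum_lessThan_2: "(\<Sum>k<2::nat. f k) = f 0 + f 1"
  by (simp add: eval_nat_numeral)

text \<open>Blocks with vanishing second column act through the first coordinate only, so their
  operator norm is the Euclidean norm of the first column.\<close>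

lemma block_bound_column:
  assumes "\<And>i. i < n \<Longrightarrow> F i 0 1 = 0 \<and> F i 1 1 = 0 \<and> (cmod (F i 0 0))\<^sup>2 + (cmod (F i 1 0))\<^sup>2 \<le> 1"
  shows "block_bound n 2 F 1"
  unfolding block_bound_def
proof (intro conjI allI impI)
  fix i v assume i: "i < n"
  have two: "(vnorm {..<2::nat} w)\<^sup>2 = (cmod (w 0))\<^sup>2 + (cmod (w 1))\<^sup>2" for w
    by (simp add: vnorm_def L2_set_def sum_lessThan_2)
  have "(vnorm {..<2} (mv {..<2} (F i) v))\<^sup>2
      = ((cmod (F i 0 0))\<^sup>2 + (cmod (F i 1 0))\<^sup>2) * (cmod (v 0))\<^sup>2"
    using assms[OF i] by (simp add: two mv_def sum_lessThan_2 norm_mult power_mult_distrib distrib_right)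
  also have "\<dots> \<le> 1 * (cmod (v 0))\<^sup>2" using assms[OF i] by (intro mult_right_mono) auto
  also have "\<dots> \<le> (vnorm {..<2} v)\<^sup>2" by (simp add: two)
  finally have "vnorm {..<2} (mv {..<2} (F i) v) \<le> vnorm {..<2} v"
    by (rule power2_le_imp_le) simp
  then show "vnorm {..<2} (mv {..<2} (F i) v) \<le> 1 * vnorm {..<2} v" by simp
qed simp

lemma block_bound_transpose_adj:
  "block_bound n m (\<lambda>i. madj (F i)) 1 \<longleftrightarrow> block_bound n m F 1"
  using block_norm_le_iff[of 1 n m "\<lambda>i. madj (F i)"] block_norm_le_iff[of 1 n m F]
  by (simp add: block_norm_adj)

text \<open>The conjugates of the vectors \<open>(e\<^sub>0 + \<i>\<^sup>k e\<^sub>1) / \<surd>2\<close>, arranged as a row over \<open>A\<close>, against \<open>e\<^sub>0\<close> and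
  \<open>e\<^sub>1\<close>, arranged as a column over \<open>B\<close>: the choice that gives equality in Cauchy-Schwarz.\<close>

definition row_entry :: "nat \<Rightarrow> 'a" where
  "row_entry l = \<iota> (\<lambda>k. if k < 4 then (if l = 0 then 1 else cnj (\<i> ^ k)) / complex_of_real (sqrt 2) else 0)"

definition column_entry :: "nat \<Rightarrow> 'a" where
  "column_entry l = \<iota> (\<lambda>j. if j < 2 \<and> j = l then 1 else 0)"

definition zero_entry :: 'a where "zero_entry = \<iota> (\<lambda>_. 0)"

lemma entries_in_carrier:
  "row_entry l \<in> carrier A" "column_entry l \<in> carrier B" "zero_entry \<in> carrier (diag_cstar \<iota> n)"
  by (simp_all add: row_entry_def column_entry_def zero_entry_def)

text \<open>The same entries are contractive both as a row and as a column because the algebra is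
  commutative: at each point they form a scalar vector, here with two entries of modulus
  \<open>1 / sqrt 2\<close>. Thus one test serves both \<open>u1\<close> and the transpose of
  \<open>u2\<close>.\<close>

lemma row_ball:
  "mat 2 2 (\<lambda>(r, l). if r = 0 then row_entry l else zero_entry) \<in> matrix_ball 2 A"
  "mat 2 2 (\<lambda>(l, r). if r = 0 then row_entry l else zero_entry) \<in> matrix_ball 2 A"
proof -
  let ?F = "\<lambda>k l r. \<kappa> (if r = 0 then row_entry l else zero_entry) k"
  \<comment> \<open>Only moduli are compared, so that the statement also covers the conjugates in
    the adjoint, from which the row case is obtained.\<close>
  have col: "block_bound 4 2 F 1" if "\<And>k l r. \<lbrakk>k < 4; l < 2; r < 2\<rbrakk> \<Longrightarrow> cmod (F k l r) = cmod (?F k l r)" for F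
  proof (rule block_bound_column)
    fix k :: nat assume k: "k < 4"
    show "F k 0 1 = 0 \<and> F k 1 1 = 0 \<and> (cmod (F k 0 0))\<^sup>2 + (cmod (F k 1 0))\<^sup>2 \<le> 1"
      using that[OF k, of 0 1] that[OF k, of 1 1] that[OF k, of 0 0] that[OF k, of 1 0] k
      by (simp add: row_entry_def zero_entry_def norm_divide power_divide cmod_i_power norm_power)
  qed
  have "block_bound 4 2 (\<lambda>k. madj (\<lambda>l r. ?F k r l)) 1" by (rule col) (auto simp: madj_def)
  then have row: "block_bound 4 2 (\<lambda>k l r. ?F k r l) 1" unfolding block_bound_transpose_adj .
  show "mat 2 2 (\<lambda>(r, l). if r = 0 then row_entry l else zero_entry) \<in> matrix_ball 2 A"
    unfolding matrix_ball_diag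
  proof (intro conjI)
    show "block_bound 4 2 (\<lambda>k r l. \<kappa> (mat 2 2 (\<lambda>(r, l). if r = 0 then row_entry l else zero_entry) $$ (r, l)) k) 1"
      by (rule iffD2[OF block_bound_cong row]) simp
  qed (simp_all add: entries_in_carrier)
  show "mat 2 2 (\<lambda>(l, r). if r = 0 then row_entry l else zero_entry) \<in> matrix_ball 2 A"
    unfolding matrix_ball_diag
  proof (intro conjI)
    show "block_bound 4 2 (\<lambda>k l r. \<kappa> (mat 2 2 (\<lambda>(l, r). if r = 0 then row_entry l else zero_entry) $$ (l, r)) k) 1"
      by (rule iffD2[OF block_bound_cong col[of ?F]]) simp_all
  qed (simp_all add: entries_in_carrier)
qed

text \<open>As for \<open>row_ball\<close>; at each of the two points exactly one entry is 1 and the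
  other is 0.\<close>

lemma column_ball:
  "mat 2 2 (\<lambda>(r, l). if r = 0 then column_entry l else zero_entry) \<in> matrix_ball 2 B"
  "mat 2 2 (\<lambda>(l, r). if r = 0 then column_entry l else zero_entry) \<in> matrix_ball 2 B"
proof -
  let ?F = "\<lambda>k l r. \<kappa> (if r = 0 then column_entry l else zero_entry) k"
  have col: "block_bound 2 2 F 1" if "\<And>k l r. \<lbrakk>k < 2; l < 2; r < 2\<rbrakk> \<Longrightarrow> cmod (F k l r) = cmod (?F k l r)" for F
  proof (rule block_bound_column)
    fix k :: nat assume k: "k < 2"
    show "F k 0 1 = 0 \<and> F k 1 1 = 0 \<and> (cmod (F k 0 0))\<^sup>2 + (cmod (F k 1 0))\<^sup>2 \<le> 1"
      using that[OF k, of 0 1] that[OF k, of 1 1] that[OF k, of 0 0] that[OF k, of 1 0] k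
      by (simp add: column_entry_def zero_entry_def)
  qed
  have "block_bound 2 2 (\<lambda>k. madj (\<lambda>l r. ?F k r l)) 1" by (rule col) (auto simp: madj_def)
  then have row: "block_bound 2 2 (\<lambda>k l r. ?F k r l) 1" unfolding block_bound_transpose_adj .
  show "mat 2 2 (\<lambda>(r, l). if r = 0 then column_entry l else zero_entry) \<in> matrix_ball 2 B"
    unfolding matrix_ball_diag
  proof (intro conjI)
    show "block_bound 2 2 (\<lambda>k r l. \<kappa> (mat 2 2 (\<lambda>(r, l). if r = 0 then column_entry l else zero_entry) $$ (r, l)) k) 1"
      by (rule iffD2[OF block_bound_cong row]) simp
  qed (simp_all add: entries_in_carrier)
  show "mat 2 2 (\<lambda>(l, r). if r = 0 then column_entry l else zero_entry) \<in> matrix_ball 2 B"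
    unfolding matrix_ball_diag
  proof (intro conjI)
    show "block_bound 2 2 (\<lambda>k l r. \<kappa> (mat 2 2 (\<lambda>(l, r). if r = 0 then column_entry l else zero_entry) $$ (l, r)) k) 1"
      by (rule iffD2[OF block_bound_cong col[of ?F]]) simp_all
  qed (simp_all add: entries_in_carrier)
qed

text \<open>The sum is the entry at \<open>(0, 0)\<close> of the amplification, and an entry is
  bounded by the operator norm.\<close>

lemma cb_norm_ge:
  assumes "1 \<le> n" "X \<in> matrix_ball n C" "Y \<in> matrix_ball n D"
  shows "ennreal (cmod (\<Sum>l<n. w (X $$ (0, l)) (Y $$ (l, 0)))) \<le> cb_norm C D w"
proof -
  have "ennreal (cmod (\<Sum>l<n. w (X $$ (0, l)) (Y $$ (l, 0)))) \<le> cmat_norm (amplification n w X Y)"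
    using cmod_entry_le_cmat_norm[of 0 "amplification n w X Y" 0] assms
    by (simp add: amplification_def)
  also have "\<dots> \<le> cb_norm C D w"
    unfolding cb_norm_def using assms
    by (intro SUP_upper2[of n] SUP_upper2[of X] SUP_upper2[of Y]) auto
  finally show ?thesis .
qed

lemma gap_form_decomposition:
  assumes u: "\<And>a b. \<lbrakk>a \<in> carrier A; b \<in> carrier B\<rbrakk> \<Longrightarrow> gap_form a b = u1 a b + u2 a b"
  shows "ennreal (4 * sqrt 2) \<le> cb_norm A B u1 + cb_norm B A (transpose_form u2)"
proof -
  let ?s1 = "\<Sum>l<2. u1 (row_entry l) (column_entry l)" and ?s2 = "\<Sum>l<2. u2 (row_entry l) (column_entry l)"
  have "?s1 + ?s2 = (\<Sum>l<2. gap_form (row_entry l) (column_entry l))"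
    by (simp add: sum.distrib u row_entry_def column_entry_def)
  \<comment> \<open>Each \<open>l\<close> contributes four terms \<open>1 / sqrt 2\<close>; for
    \<open>l = 1\<close> the conjugated root of unity cancels the one in the form.\<close>
  also have "\<dots> = complex_of_real (8 / sqrt 2)"
    by (simp add: gap_form_def row_entry_def column_entry_def sum_lessThan_4 numeral_2_eq_2 eval_nat_numeral field_simps)
  also have "8 / sqrt 2 = 4 * sqrt 2" by (simp add: field_simps)
  finally have "4 * sqrt 2 = cmod (?s1 + ?s2)" by (simp add: norm_mult)
  also have "\<dots> \<le> cmod ?s1 + cmod ?s2" by (rule norm_triangle_ineq)
  finally have "ennreal (4 * sqrt 2) \<le> ennreal (cmod ?s1) + ennreal (cmod ?s2)"
    by (simp add: ennreal_leI flip: ennreal_plus)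
  also have "\<dots> \<le> cb_norm A B u1 + cb_norm B A (transpose_form u2)"
    using cb_norm_ge[OF _ row_ball(1) column_ball(2), of u1]
      cb_norm_ge[OF _ column_ball(1) row_ball(2), of "transpose_form u2"]
    by (intro add_mono) (simp_all add: transpose_form_def)
  finally show ?thesis .
qed

lemma decomposition_constant_ge:
  assumes "0 \<le> K" "decomposition_constant TYPE('a) K"
  shows "4 * sqrt 2 \<le> K * gap_const"
proof -
  have "jointly_completely_bounded A B gap_form"
    using bounded_gap_form order_le_less_trans[OF jcb_norm_gap_form ennreal_less_top]
    by (simp add: jointly_completely_bounded_def)
  then obtain u1 u2 where "\<forall>a\<in>carrier A. \<forall>b\<in>carrier B. gap_form a b = u1 a b + u2 a b"
    and le: "cb_norm A B u1 + cb_norm B A (transpose_form u2) \<le> ennreal K * jcb_norm A B gap_form"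
    using assms(2) cstar_algebra_diag unfolding decomposition_constant_def by blast
  then have "ennreal (4 * sqrt 2) \<le> ennreal K * jcb_norm A B gap_form"
    using gap_form_decomposition[of u1 u2] order_trans by blast
  also have "\<dots> \<le> ennreal K * ennreal gap_const"
    by (intro mult_left_mono jcb_norm_gap_form) simp
  also have "\<dots> = ennreal (K * gap_const)" using assms by (simp add: ennreal_mult' )
  finally show ?thesis using assms by (simp add: ennreal_le_iff gap_const_def)
qed

end

theorem theorem6p3:
  assumes "(UNIV :: real set) \<lesssim> (UNIV :: 'a set)"
  shows "K_best TYPE('a) > 1"
proof -
  obtain \<iota> :: "(nat \<Rightarrow> complex) \<Rightarrow> 'a" where "inj \<iota>" using exists_embedding[OF assms] by blast
  then interpret embedding \<iota> by unfold_locales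
  \<comment> \<open>The ratio of \<open>4 * sqrt 2\<close> to \<open>gap_const\<close>. One bound
    above 1 for all admissible \<open>K\<close> is what makes the inequality strict for the
    infimum.\<close>
  have "16 / (16 - 1/100) \<le> K" if "0 \<le> K" "decomposition_constant TYPE('a) K" for K :: real
  proof -
    have "2 * sqrt 2 * (4 * sqrt 2) \<le> 2 * sqrt 2 * (K * gap_const)"
      using decomposition_constant_ge[OF that] by (intro mult_left_mono) auto
    moreover have "2 * sqrt 2 * (4 * sqrt 2) = 8 * (sqrt 2)\<^sup>2" by (simp add: power2_eq_square)
    moreover have "2 * sqrt 2 * gap_const = 16 - 1/100" by (simp add: gap_const_def)
    then have "2 * sqrt 2 * (K * gap_const) = K * (16 - 1/100)" by (simp only: mult.left_commute[of _ K])
    ultimately have "16 \<le> K * (16 - 1/100)" by simp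
    then show ?thesis by simp
  qed
  then have "ennreal (16 / (16 - 1/100)) \<le> K_best TYPE('a)"
    unfolding K_best_def by (intro INF_greatest) (auto intro: ennreal_leI)
  moreover have "1 < ennreal (16 / (16 - 1/100))" by (subst ennreal_1[symmetric], subst ennreal_less_iff) auto
  ultimately show ?thesis by (rule less_le_trans[rotated])
qed

end
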